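(* Let $p\ge2$, let $a_1,\dots,a_k\in\mathbb R^p\setminus\{0\}$, and let $c_1,\dots,c_k\in\mathbb R$ satisfy $\sum_j c_j=1$. Combine all indices whose vectors determine the same projective direction (i.e. group indices with parallel vectors and add their coefficients), omit any groups whose combined coefficient is zero, and write $b_1,\dots,b_m$ for the remaining combined coefficients. Set $$T_{a,c}(u):=\sum_{j=1}^k c_j\frac{a_j}{a_j^\top u}-u .$$ Then $$\mathcal L\{T_{a,c}(U)^\top V\mid P\}=\mathrm{Cauchy}(0,1)\quad\text{for Haar-almost every oriented two-plane }P$$ if and only if $b_\ell>0$ for every $\ell=1,\dots,m$.
   Context: $(U,V)$ is a Haar-distributed orthonormal two-frame in $\mathbb R^p$ (equivalently, the first two columns of a Haar matrix in $O(p)$), and $P=\operatorname{span}\{U,V\}$ with the orientation induced by the ordered frame, a random element of the oriented Grassmannian. $\mathcal L\{\cdot\mid P\}$ denotes the conditional law given $P$. Conditional on $P$ with positive orthonormal basis $(e_1,e_2)$, one has $U=e_1\cos\phi+e_2\sin\phi$, $V=-e_1\sin\phi+e_2\cos\phi$ with $\phi$ uniform modulo $2\pi$. The field $T_{a,c}$ is defined for $u\in\mathbb S^{p-1}$ off the Haar-null set where some $a_j^\top u=0$. *)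

theory Defs
  imports "HOL-Probability.Probability"
begin

section \<open>Haar-distributed orthonormal two-frames\<close>

definition orthogonal_group :: "(real^'n^'n) set" where
  "orthogonal_group = {Q. orthogonal_matrix Q}"

text \<open>
  The normalised Haar measure of the compact group \<open>O(p)\<close>, \<open>p = CARD('n)\<close>, is the unique Borel
  probability measure on it that is invariant under left and right translations; the predicate
  below therefore singles out exactly one measure.
\<close>
definition haar_orthogonal :: "(real^'n^'n) measure \<Rightarrow> bool" where
  "haar_orthogonal \<nu> \<longleftrightarrow>
     prob_space \<nu> \<and> sets \<nu> = sets (restrict_space borel orthogonal_group) \<and>
     (\<forall>Q\<in>orthogonal_group. distr \<nu> \<nu> (\<lambda>A. Q ** A) = \<nu> \<and> distr \<nu> \<nu> (\<lambda>A. A ** Q) = \<nu>)"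

definition orthonormal_frames :: "((real^'n) \<times> (real^'n)) set" where
  "orthonormal_frames = {(u, v). norm u = 1 \<and> norm v = 1 \<and> u \<bullet> v = 0}"

definition frame_space :: "((real^'n) \<times> (real^'n)) measure" where
  "frame_space = restrict_space borel orthonormal_frames"

text \<open>
  The index type carries no preferred order, so ``the first two columns'' of a Haar matrix are
  columns \<open>i \<noteq> j\<close>; by invariance under permutation matrices the law does not depend on the choice.
\<close>
definition haar_two_frame ::
    "'w measure \<Rightarrow> ('w \<Rightarrow> real^'n) \<Rightarrow> ('w \<Rightarrow> real^'n) \<Rightarrow> bool" where
  "haar_two_frame M U V \<longleftrightarrow>
     prob_space M \<and> (\<lambda>\<omega>. (U \<omega>, V \<omega>)) \<in> M \<rightarrow>\<^sub>M frame_space \<and>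
     (\<exists>\<nu> i j. haar_orthogonal \<nu> \<and> i \<noteq> j \<and>
        distr M frame_space (\<lambda>\<omega>. (U \<omega>, V \<omega>))
          = distr \<nu> frame_space (\<lambda>A. (column i A, column j A)))"

section \<open>Oriented two-planes\<close>

text \<open>
  An oriented plane is a plane together with an orientation, i.e. the set of all positively
  oriented ordered bases.
\<close>
type_synonym 'n oriented_plane = "(real^'n) set \<times> ((real^'n) \<times> (real^'n)) set"

definition oriented_span :: "(real^'n) \<times> (real^'n) \<Rightarrow> 'n oriented_plane" where
  "oriented_span = (\<lambda>(u, v).
     (span {u, v},
      {(\<alpha> *\<^sub>R u + \<beta> *\<^sub>R v, \<gamma> *\<^sub>R u + \<delta> *\<^sub>R v) | \<alpha> \<beta> \<gamma> \<delta>. \<alpha> * \<delta> - \<beta> * \<gamma> > 0}))"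

definition oriented_planes :: "'n::finite oriented_plane set" where
  "oriented_planes = oriented_span ` orthonormal_frames"

text \<open>
  The oriented Grassmannian is the quotient of the space of orthonormal frames by rotations within
  the plane, and carries the quotient \<open>\<sigma>\<close>-algebra.
\<close>
definition oriented_grassmannian :: "'n::finite oriented_plane measure" where
  "oriented_grassmannian =
     sigma oriented_planes
       {A. A \<subseteq> oriented_planes \<and>
           oriented_span -` A \<inter> orthonormal_frames \<in> sets frame_space}"

section \<open>Conditional laws\<close>

definition regular_conditional_law ::
    "'w measure \<Rightarrow> ('w \<Rightarrow> 'x) \<Rightarrow> 'x measure \<Rightarrow> ('w \<Rightarrow> 'y) \<Rightarrow> 'y measure \<Rightarrow> ('y \<Rightarrow> 'x measure) \<Rightarrow> bool"
  where
  "regular_conditional_law M X N Y G K \<longleftrightarrow>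
     K \<in> G \<rightarrow>\<^sub>M prob_algebra N \<and>
     (\<forall>A\<in>sets G. \<forall>B\<in>sets N.
        emeasure M {\<omega>\<in>space M. Y \<omega> \<in> A \<and> X \<omega> \<in> B}
          = (\<integral>\<^sup>+\<omega>. emeasure (K (Y \<omega>)) B * indicator A (Y \<omega>) \<partial>M))"

text \<open>
  \<open>cond_law M X N Y G y\<close> is the law of \<open>X\<close> (with values in \<open>N\<close>) given \<open>Y = y\<close> (with values in \<open>G\<close>).
  When \<open>N\<close> is the Borel space of \<open>\<real>\<close>, a version exists and any two versions agree for almost
  every \<open>y\<close> under the law of \<open>Y\<close>.
\<close>
definition cond_law ::
    "'w measure \<Rightarrow> ('w \<Rightarrow> 'x) \<Rightarrow> 'x measure \<Rightarrow> ('w \<Rightarrow> 'y) \<Rightarrow> 'y measure \<Rightarrow> 'y \<Rightarrow> 'x measure"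
  where
  "cond_law M X N Y G = (SOME K. regular_conditional_law M X N Y G K)"

definition cauchy_distribution :: "real \<Rightarrow> real \<Rightarrow> real measure" where
  "cauchy_distribution x0 s =
     density lborel (\<lambda>x. ennreal (s / (pi * (s\<^sup>2 + (x - x0)\<^sup>2))))"

section \<open>The field and the combined coefficients\<close>

text \<open>
  Where some \<open>a j \<bullet> u\<close> vanishes the value below is an artefact of division by zero; for nonzero
  \<open>a j\<close> this is a Haar-null set.
\<close>
definition T_field :: "nat \<Rightarrow> (nat \<Rightarrow> real^'n) \<Rightarrow> (nat \<Rightarrow> real) \<Rightarrow> real^'n \<Rightarrow> real^'n" where
  "T_field k a c u = (\<Sum>j\<in>{1..k}. (c j / (a j \<bullet> u)) *\<^sub>R a j) - u"

text \<open>
  The projective direction of a nonzero vector is the line it spans.  The combined coefficients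
  \<open>b\<^sub>1, \<dots>, b\<^sub>m\<close> are indexed by the remaining directions.
\<close>
definition combined_coeff ::
    "nat \<Rightarrow> (nat \<Rightarrow> real^'n) \<Rightarrow> (nat \<Rightarrow> real) \<Rightarrow> (real^'n) set \<Rightarrow> real" where
  "combined_coeff k a c L = (\<Sum>j | j \<in> {1..k} \<and> span {a j} = L. c j)"

definition remaining_directions ::
    "nat \<Rightarrow> (nat \<Rightarrow> real^'n) \<Rightarrow> (nat \<Rightarrow> real) \<Rightarrow> (real^'n) set set" where
  "remaining_directions k a c =
     {L \<in> (\<lambda>j. span {a j}) ` {1..k}. combined_coeff k a c L \<noteq> 0}"

end

theory Submission
  imports Defs "HOL-Complex_Analysis.Cauchy_Integral_Formula" "HOL-Real_Asymp.Real_Asymp"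
begin

text \<open>
  Write a unit vector in the plane \<open>P\<close> as \<open>U = e\<^sub>1 cos \<phi> + e\<^sub>2 sin \<phi>\<close>, so that \<open>V\<close> is its derivative in \<open>\<phi>\<close>. If the projection of
  \<open>a\<^sub>j\<close> to \<open>P\<close> has angle \<open>\<theta>\<^sub>j\<close>, then \<open>(a\<^sub>j \<bullet> V) / (a\<^sub>j \<bullet> U) = tan (\<theta>\<^sub>j - \<phi>)\<close>, and since \<open>U \<bullet> V = 0\<close> the field contributes
  \<open>T(U) \<bullet> V = \<Sum>\<^sub>l b\<^sub>l tan (\<theta>\<^sub>l - \<phi>)\<close>, with one term for each remaining direction
  (lemma \<open>T_field_rotate_frame\<close>). Given \<open>P\<close>, the phase \<open>\<phi>\<close> is uniform, so the question is when a sum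
  of tangents with total weight \<open>1\<close> and a uniform phase has the Cauchy law.

  The function \<open>\<i> tan\<close> is the boundary value of a Cayley transform, which maps the disc to a half plane. If all
  weights are positive, the weighted sum extends to the disc with values in this half plane, its exponential is
  bounded and holomorphic, and the mean value property computes the
  characteristic function as \<open>exp (- \<bar>t\<bar>)\<close> (lemma \<open>char_tangent_sum\<close>). Conversely, the tail of a sum of
  tangents with distinct poles is governed by the sum of the absolute values of the weights. For the Cauchy law this
  sum is at most \<open>1\<close>, the sum of the weights themselves, so no weight is negative
  (lemma \<open>distr_tangent_sum_cauchy_imp_pos\<close>).

  Two further points are needed. The first is that the conditional law given the plane is the law along the orbit
  of a frame under rotation (lemma \<open>cond_law_plane_eq_iff\<close>); this follows from the invariance of Haar measure under
  right translations and from the almost sure uniqueness of conditional laws. The second is that almost every plane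
  is in general position: no \<open>a\<^sub>j\<close> projects to zero, and nonparallel vectors have nonparallel projections
  (lemma \<open>haar_two_frame_AE_generic\<close>). Left invariance makes certain hyperplane probabilities equal for infinitely
  many hyperplanes taken from the moment curve, and a given vector lies in only finitely many of these.
\<close>

section \<open>A uniform phase\<close>

definition unit_uniform :: "real measure" where
  "unit_uniform = restrict_space lborel {0..1}"

lemma space_unit_uniform [simp]: "space unit_uniform = {0..1}"
  by (simp add: unit_uniform_def space_restrict_space)

lemma prob_space_unit_uniform: "prob_space unit_uniform"
  by (auto simp: unit_uniform_def emeasure_restrict_space space_restrict_space intro!: prob_spaceI)

interpretation unit_uniform: prob_space unit_uniform
  by (rule prob_space_unit_uniform)

lemma measurable_unit_uniform [measurable (raw)]:
  "f \<in> borel \<rightarrow>\<^sub>M N \<Longrightarrow> f \<in> unit_uniform \<rightarrow>\<^sub>M N"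
  by (simp add: unit_uniform_def measurable_restrict_space1)

lemma integral_unit_uniform:
  fixes f :: "real \<Rightarrow> 'a :: {banach, second_countable_topology}"
  shows "(LINT s|unit_uniform. f s) = (LINT s:{0..1}|lborel. f s)"
  by (simp add: unit_uniform_def integral_restrict_space set_lebesgue_integral_def)

lemma borel_measurable_tan [measurable]: "(tan :: real \<Rightarrow> real) \<in> borel_measurable borel"
  unfolding tan_def[abs_def] by measurable

lemma AE_unit_uniform_countable:
  assumes "countable {s. \<not> Q s}"
  shows "AE s in unit_uniform. Q s"
proof -
  have "AE s in lborel. Q s"
    using countable_imp_null_set_lborel[OF assms] by (intro AE_I'[of "{s. \<not> Q s}"]) auto
  thus ?thesis
    unfolding unit_uniform_def by (subst AE_restrict_space_iff) (auto elim!: eventually_mono)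
qed

lemma AE_cos_nonzero:
  assumes "n > 0"
  shows "AE s in unit_uniform. cos (real n * pi * s - x) \<noteq> 0"
proof (rule AE_unit_uniform_countable)
  have "{s. \<not> cos (real n * pi * s - x) \<noteq> 0} \<subseteq> range (\<lambda>i::int. (of_int i * (pi/2) + x) / (real n * pi))"
  proof
    fix s assume "s \<in> {s. \<not> cos (real n * pi * s - x) \<noteq> 0}"
    then obtain i :: int where "real n * pi * s - x = of_int i * (pi/2)"
      by (auto simp: cos_zero_iff_int)
    thus "s \<in> range (\<lambda>i::int. (of_int i * (pi/2) + x) / (real n * pi))"
      using assms by (intro image_eqI[of _ _ i]) (auto simp: field_simps)
  qed
  thus "countable {s. \<not> cos (real n * pi * s - x) \<noteq> 0}"
    by (rule countable_subset) simp
qed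

section \<open>The characteristic function of a nonnegative sum of tangents\<close>

text \<open>
  This is Cauchy's integral formula at the centre of the disc; the parameter of the circle
  serves as the uniform phase.
\<close>
lemma mean_value_circle:
  fixes f :: "complex \<Rightarrow> complex"
  assumes "f holomorphic_on cball 0 r" "0 < r"
  shows "(LINT s|unit_uniform. f (of_real r * exp (2 * pi * \<i> * of_real s))) = f 0"
proof -
  define g where "g s = of_real r * exp (2 * pi * \<i> * of_real s)" for s
  have g: "circlepath 0 r = g"
    by (auto simp: circlepath g_def)
  have nz: "g s \<noteq> 0" for s
    using assms by (simp add: g_def)
  have "((\<lambda>u. f u / (u - 0)) has_contour_integral (2 * of_real pi * \<i> * f 0)) (circlepath 0 r)"
    using assms by (intro Cauchy_integral_circlepath_simple) auto
  hence "((\<lambda>s. f (g s) / g s * (2 * pi * \<i> * r * exp (2 * of_real pi * \<i> * of_real s)))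
           has_integral (2 * of_real pi * \<i> * f 0)) {0..1}"
    unfolding has_contour_integral_def
    by (rule has_integral_eq[rotated])
       (use vector_derivative_circlepath01[of _ 0 r] in \<open>auto simp: g mult_ac\<close>)
  hence I: "((\<lambda>s. 2 * pi * \<i> * f (g s)) has_integral (2 * pi * \<i> * f 0)) {0..1}"
    unfolding of_real_mult of_real_numeral by (rule has_integral_eq[rotated]) (use nz in \<open>auto simp: g_def field_simps\<close>)
  have cancel: "inverse (2 * pi * \<i>) * (2 * pi * \<i> * x) = x" for x
    by (simp add: field_simps)
  from I have "((\<lambda>s. inverse (2 * pi * \<i>) * (2 * pi * \<i> * f (g s)))
      has_integral (inverse (2 * pi * \<i>) * (2 * pi * \<i> * f 0))) {0..1}"
    by (rule has_integral_mult_right)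
  hence I: "((\<lambda>s. f (g s)) has_integral f 0) {0..1}"
    unfolding cancel .
  have "continuous_on {0..1} (\<lambda>s. f (g s))"
  proof (rule continuous_on_compose2[OF holomorphic_on_imp_continuous_on[OF assms(1)]])
    show "continuous_on {0..1} g"
      unfolding g_def by (intro continuous_intros)
    show "g ` {0..1} \<subseteq> cball 0 r"
      using assms by (auto simp: g_def norm_mult)
  qed
  hence "set_integrable lborel {0..1} (\<lambda>s. f (g s))"
    unfolding set_integrable_def by (intro borel_integrable_compact) auto
  from set_borel_integral_eq_integral(2)[OF this] I show ?thesis
    unfolding integral_unit_uniform g_def by (simp add: integral_unique)
qed

text \<open>
  The Cayley transform \<open>w \<mapsto> (w - 1) / (w + 1)\<close> maps the open unit disc to the left half plane; on the
  circle it is the tangent of half the argument, rotated onto the imaginary axis. At \<open>w = -1\<close> both sides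
  are \<open>0\<close>, because division by zero gives zero.
\<close>
lemma cayley_eq_tan: "(exp (2 * \<i> * of_real x) - 1) / (exp (2 * \<i> * of_real x) + 1) = \<i> * of_real (tan x)"
proof -
  let ?e = "exp (\<i> * of_real x)"
  have e2: "exp (2 * \<i> * of_real x) = ?e * ?e"
    by (simp add: exp_add[symmetric] algebra_simps)
  have inv: "exp (- (\<i> * of_real x)) * ?e = 1"
    by (simp add: exp_add[symmetric])
  have c: "exp (2 * \<i> * of_real x) + 1 = 2 * ?e * of_real (cos x)"
    unfolding e2 using inv by (simp add: cos_exp_eq cos_of_real[symmetric] algebra_simps del: cos_of_real)
  have s: "exp (2 * \<i> * of_real x) - 1 = 2 * \<i> * ?e * of_real (sin x)"
  proof -
    have "2 * \<i> * of_real (sin x) = ?e - exp (- (\<i> * of_real x))"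
      by (simp add: sin_exp_eq sin_of_real[symmetric] del: sin_of_real)
    hence "?e * (2 * \<i> * of_real (sin x)) = ?e * (?e - exp (- (\<i> * of_real x)))"
      by (rule arg_cong)
    thus ?thesis
      unfolding e2 using inv by (simp add: algebra_simps)
  qed
  show ?thesis
    unfolding c s by (simp add: tan_def)
qed

lemma Re_cayley_nonpos:
  assumes "norm w \<le> 1"
  shows "Re ((w - 1) / (w + 1)) \<le> 0"
proof -
  have "(Re w)\<^sup>2 + (Im w)\<^sup>2 \<le> 1"
    using assms by (metis cmod_power2 norm_ge_zero power_le_one)
  hence "(Re w - 1) * (Re w + 1) + Im w * Im w \<le> 0"
    by (simp add: algebra_simps power2_eq_square)
  thus ?thesis
    by (auto simp: Re_divide intro!: divide_nonpos_nonneg)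
qed

text \<open>
  The left-hand side is the boundary value of the exponential of \<open>t\<close> times a nonnegative combination of
  rotated Cayley transforms of \<open>z\<^sup>n\<close>. This function is holomorphic in the unit disc and bounded by \<open>1\<close>
  there, so its mean over a circle of radius \<open>r < 1\<close> is its value at the centre, where each Cayley
  transform is \<open>-1\<close>; dominated convergence as \<open>r\<close> tends to \<open>1\<close> gives the boundary mean.
\<close>
lemma integral_exp_tangent_sum:
  fixes b \<theta> :: "'i \<Rightarrow> real"
  assumes D: "finite D" "\<And>i. i \<in> D \<Longrightarrow> b i \<ge> 0" and n: "n > 0" and t: "t \<ge> 0"
  shows "(LINT s|unit_uniform. exp (\<i> * of_real (t * (\<Sum>i\<in>D. b i * tan (real n * pi * s - \<theta> i))))) =
           exp (- of_real (t * (\<Sum>i\<in>D. b i)))"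
proof -
  define w where "w i z = z ^ n * exp (- 2 * \<i> * of_real (\<theta> i))" for i and z :: complex
  define G where "G z = exp (of_real t * (\<Sum>i\<in>D. of_real (b i) * ((w i z - 1) / (w i z + 1))))" for z
  define r where "r k = 1 - 1 / (real k + 2)" for k
  have r: "0 < r k" "r k < 1" for k by (auto simp: r_def)
  define e where "e s = exp (2 * pi * \<i> * of_real s)" for s
  have norm_w: "norm (w i z) = norm z ^ n" for i z
    by (simp add: w_def norm_mult norm_power)
  have norm_e: "norm (e s) = 1" for s by (simp add: e_def)
  have norm_G: "norm (G z) \<le> 1" if "norm z \<le> 1" for z
  proof -
    have "Re (of_real (b i) * ((w i z - 1) / (w i z + 1))) \<le> 0" if "i \<in> D" for i
    proof -
      have "Re (of_real (b i) * ((w i z - 1) / (w i z + 1))) = b i * Re ((w i z - 1) / (w i z + 1))"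
        by (simp only: times_complex.sel Re_complex_of_real Im_complex_of_real mult_zero_left diff_zero)
      also have "\<dots> \<le> 0"
        using D(2)[OF \<open>i \<in> D\<close>] \<open>norm z \<le> 1\<close>
        by (intro mult_nonneg_nonpos Re_cayley_nonpos) (auto simp: norm_w power_le_one)
      finally show ?thesis .
    qed
    hence "Re (\<Sum>i\<in>D. of_real (b i) * ((w i z - 1) / (w i z + 1))) \<le> 0"
      unfolding Re_sum by (rule sum_nonpos)
    hence "t * Re (\<Sum>i\<in>D. of_real (b i) * ((w i z - 1) / (w i z + 1))) \<le> 0"
      by (rule mult_nonneg_nonpos[OF t])
    thus ?thesis
      unfolding G_def norm_exp_eq_Re times_complex.sel by (simp only: Re_complex_of_real Im_complex_of_real mult_zero_left diff_zero exp_le_one_iff)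
  qed
  have we: "w i (e s) = exp (2 * \<i> * of_real (real n * pi * s - \<theta> i))" for i s
    by (simp add: w_def e_def exp_of_nat_mult[symmetric] exp_add[symmetric] algebra_simps)
  have Ge: "G (e s) = exp (\<i> * of_real (t * (\<Sum>i\<in>D. b i * tan (real n * pi * s - \<theta> i))))" for s
    unfolding G_def we cayley_eq_tan by (simp add: sum_distrib_left algebra_simps)
  have mv: "(LINT s|unit_uniform. G (of_real (r k) * e s)) = G 0" for k
    unfolding e_def
  proof (rule mean_value_circle)
    have "w i z \<noteq> -1" if "z \<in> cball 0 (r k)" for i z
    proof
      assume "w i z = -1"
      hence "norm z ^ n = 1" using norm_w[of i z] by simp
      moreover have "norm z ^ n < 1"
        using power_strict_mono[of "norm z" 1 n] that r[of k] n by simp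
      ultimately show False by simp
    qed
    hence "w i z + 1 \<noteq> 0" if "z \<in> cball 0 (r k)" for i z
      using that by (metis add_eq_0_iff2)
    thus "G holomorphic_on cball 0 (r k)"
      unfolding G_def by (auto intro!: holomorphic_intros simp: w_def)
  qed (use r in auto)
  have G0: "G 0 = exp (- of_real (t * (\<Sum>i\<in>D. b i)))"
    using n by (simp add: G_def w_def sum_negf zero_power)
  have cont: "isCont G (e s)" if "\<forall>i\<in>D. cos (real n * pi * s - \<theta> i) \<noteq> 0" for s
  proof -
    have "w i (e s) + 1 \<noteq> 0" if "i \<in> D" for i
    proof
      assume "w i (e s) + 1 = 0"
      hence "exp (2 * \<i> * of_real (real n * pi * s - \<theta> i)) = -1"
        unfolding we by (simp add: add_eq_0_iff2)
      hence "Re (exp (2 * \<i> * of_real (real n * pi * s - \<theta> i))) = -1" by simp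
      hence "cos (2 * (real n * pi * s - \<theta> i)) = -1"
        by (simp add: Re_exp algebra_simps)
      hence "cos (real n * pi * s - \<theta> i) = 0"
        unfolding cos_double_cos by simp
      thus False using \<open>\<forall>i\<in>D. _\<close> that by auto
    qed
    thus ?thesis
      unfolding G_def w_def by (intro continuous_intros) auto
  qed
  have "(\<lambda>k. LINT s|unit_uniform. G (of_real (r k) * e s)) \<longlonglongrightarrow> (LINT s|unit_uniform. G (e s))"
  proof (rule integral_dominated_convergence[where w = "\<lambda>_. 1"])
    show "(\<lambda>s. G (e s)) \<in> borel_measurable unit_uniform"
      unfolding Ge by measurable
    show "(\<lambda>s. G (of_real (r k) * e s)) \<in> borel_measurable unit_uniform" for k
      unfolding G_def w_def e_def by measurable
    have "AE s in unit_uniform. \<forall>i\<in>D. cos (real n * pi * s - \<theta> i) \<noteq> 0"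
      using D n by (intro AE_finite_allI AE_cos_nonzero)
    thus "AE s in unit_uniform. (\<lambda>k. G (of_real (r k) * e s)) \<longlonglongrightarrow> G (e s)"
    proof eventually_elim
      case (elim s)
      have "r \<longlonglongrightarrow> 1" unfolding r_def by real_asymp
      hence "(\<lambda>k. of_real (r k) * e s) \<longlonglongrightarrow> of_real 1 * e s"
        by (intro tendsto_intros)
      thus ?case
        using isCont_tendsto_compose[OF cont[OF elim]] by simp
    qed
    show "AE s in unit_uniform. norm (G (of_real (r k) * e s)) \<le> 1" for k
      using r[of k] norm_e by (intro AE_I2 norm_G) (auto simp: norm_mult)
  qed simp
  hence "(LINT s|unit_uniform. G (e s)) = G 0"
    unfolding mv by (rule LIMSEQ_unique) (rule tendsto_const)
  thus ?thesis
    unfolding Ge G0 .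
qed

text \<open>
  Holomorphy yields one sign of \<open>t\<close>; complex conjugation yields the other.
\<close>
lemma char_tangent_sum:
  fixes b \<theta> :: "'i \<Rightarrow> real"
  assumes D: "finite D" "\<And>i. i \<in> D \<Longrightarrow> b i \<ge> 0" and n: "n > 0"
  shows "char (distr unit_uniform borel (\<lambda>s. \<Sum>i\<in>D. b i * tan (\<theta> i - real n * pi * s))) t =
           exp (- of_real (\<bar>t\<bar> * (\<Sum>i\<in>D. b i)))"
proof -
  define f where "f s = (\<Sum>i\<in>D. b i * tan (\<theta> i - real n * pi * s))" for s
  have f: "(\<Sum>i\<in>D. b i * tan (real n * pi * s - \<theta> i)) = - f s" for s
    using tan_minus[of "\<theta> i - real n * pi * s" for i] by (simp add: f_def sum_negf[symmetric])
  have [measurable]: "f \<in> borel_measurable borel"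
    unfolding f_def by measurable
  have ch: "char (distr unit_uniform borel f) t = (LINT s|unit_uniform. exp (\<i> * of_real (t * f s)))"
    unfolding char_def by (subst integral_distr) auto
  have int: "(LINT s|unit_uniform. exp (\<i> * of_real (- (\<bar>t\<bar> * f s)))) = exp (- of_real (\<bar>t\<bar> * (\<Sum>i\<in>D. b i)))"
    using integral_exp_tangent_sum[where b = b and t = "\<bar>t\<bar>" and \<theta> = \<theta>, OF D n] unfolding f by simp
  have "(LINT s|unit_uniform. exp (\<i> * of_real (t * f s))) = exp (- of_real (\<bar>t\<bar> * (\<Sum>i\<in>D. b i)))"
  proof (cases "t \<le> 0")
    case True
    thus ?thesis using int by simp
  next
    case False
    have "(LINT s|unit_uniform. exp (\<i> * of_real (t * f s))) =
      (LINT s|unit_uniform. cnj (exp (\<i> * of_real (- (\<bar>t\<bar> * f s)))))"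
      using False by (simp add: exp_cnj)
    also have "\<dots> = cnj (LINT s|unit_uniform. exp (\<i> * of_real (- (\<bar>t\<bar> * f s))))"
      by (rule Bochner_Integration.integral_cnj)
    also have "\<dots> = exp (- of_real (\<bar>t\<bar> * (\<Sum>i\<in>D. b i)))"
      unfolding int exp_cnj by simp
    finally show ?thesis .
  qed
  thus ?thesis unfolding ch[symmetric] f_def[symmetric] .
qed

section \<open>Sums of tangents and the Cauchy law\<close>

lemma emeasure_standard_cauchy_atMost:
  "emeasure (cauchy_distribution 0 1) {..x} = ennreal (1/2 + arctan x / pi)"
proof -
  define f :: "real \<Rightarrow> real" where "f y = 1 / (pi * (1 + y\<^sup>2))" for y
  have [measurable]: "f \<in> borel_measurable borel"
    unfolding f_def by measurable
  have "emeasure (cauchy_distribution 0 1) {..x} = (\<integral>\<^sup>+y. ennreal (f y) * indicator {..x} y \<partial>lborel)"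
    by (simp add: cauchy_distribution_def emeasure_density f_def)
  also have "\<dots> = (\<integral>\<^sup>+y. ennreal (f y) * indicator {-x..} y \<partial>lborel)"
    by (subst nn_integral_real_affine[where c = "-1" and t = 0])
       (auto simp: f_def intro!: nn_integral_cong split: split_indicator)
  also have "\<dots> = ennreal (1/2 - arctan (-x) / pi)"
  proof (rule nn_integral_FTC_atLeast)
    show "((\<lambda>y. arctan y / pi) has_real_derivative f y) (at y)" for y
    proof -
      have "f y = inverse (1 + y\<^sup>2) / pi"
        by (simp add: f_def divide_inverse mult.commute)
      thus ?thesis
        using DERIV_cdivide[OF DERIV_arctan] by simp
    qed
    show "f y \<ge> 0" for y
      by (auto simp: f_def intro!: divide_nonneg_nonneg mult_nonneg_nonneg add_nonneg_nonneg)
    have "((\<lambda>y. arctan y / pi) \<longlongrightarrow> pi / 2 / pi) at_top"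
      by (intro tendsto_intros tendsto_arctan_at_top) auto
    thus "((\<lambda>y. arctan y / pi) \<longlongrightarrow> 1/2) at_top" by simp
  qed simp
  finally show ?thesis by (simp add: arctan_minus)
qed

lemma tan_half_turn_le_iff:
  assumes "0 < s" "s < 1"
  shows "tan (pi/2 - pi * s) \<le> x \<longleftrightarrow> 1/2 - arctan x / pi \<le> s"
proof -
  have "arctan (tan (pi/2 - pi * s)) = pi/2 - pi * s"
    using assms by (intro arctan_tan) auto
  hence "tan (pi/2 - pi * s) \<le> x \<longleftrightarrow> pi/2 - pi * s \<le> arctan x"
    by (metis arctan_le_iff)
  thus ?thesis by (simp add: field_simps)
qed

text \<open>
  A single tangent has the Cauchy law by inspection of distribution functions. The endpoints of the unit
  interval, where the tangent has its pole, are discarded as a null set.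
\<close>
lemma distr_tan_eq_cauchy:
  "distr unit_uniform borel (\<lambda>s. tan (pi/2 - pi * s)) = cauchy_distribution 0 1"
proof (rule measure_eqI_generator_eq[where E = "range atMost" and A = "\<lambda>i::nat. {..real i}" and \<Omega> = UNIV])
  fix X :: "real set" assume "X \<in> range atMost"
  then obtain x where X: "X = {..x}" by auto
  have at: "\<bar>arctan x\<bar> < pi/2"
    using arctan_bounded[of x] by auto
  have "emeasure (distr unit_uniform borel (\<lambda>s. tan (pi/2 - pi * s))) X =
    emeasure unit_uniform {s\<in>space unit_uniform. tan (pi/2 - pi * s) \<le> x}"
    unfolding X by (subst emeasure_distr) (auto intro!: arg_cong2[where f = emeasure])
  also have "\<dots> = emeasure unit_uniform {s\<in>space unit_uniform. 1/2 - arctan x / pi \<le> s}"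
  proof (rule emeasure_eq_AE)
    have "AE s in unit_uniform. s \<noteq> 0" "AE s in unit_uniform. s \<noteq> 1"
      by (auto intro!: AE_unit_uniform_countable)
    thus "AE s in unit_uniform. s \<in> {s\<in>space unit_uniform. tan (pi/2 - pi * s) \<le> x} \<longleftrightarrow>
        s \<in> {s\<in>space unit_uniform. 1/2 - arctan x / pi \<le> s}"
      by eventually_elim (auto simp: tan_half_turn_le_iff)
  qed measurable
  also have "{s\<in>space unit_uniform. 1/2 - arctan x / pi \<le> s} = {1/2 - arctan x / pi..1}"
  proof -
    have "0 \<le> 1/2 - arctan x / pi"
      using at by (simp add: field_simps)
    thus ?thesis
      unfolding space_unit_uniform by (intro set_eqI) (smt (verit) atLeastAtMost_iff mem_Collect_eq)
  qed
  also have "emeasure unit_uniform \<dots> = ennreal (1/2 + arctan x / pi)"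
    using at unfolding unit_uniform_def by (subst emeasure_restrict_space) (auto simp: field_simps)
  also have "\<dots> = emeasure (cauchy_distribution 0 1) X"
    unfolding X by (simp add: emeasure_standard_cauchy_atMost)
  finally show "emeasure (distr unit_uniform borel (\<lambda>s. tan (pi/2 - pi * s))) X =
      emeasure (cauchy_distribution 0 1) X" .
next
  show "Int_stable (range atMost :: real set set)"
    by (auto simp: Int_stable_def)
  show "(\<Union>i. {..real i}) = UNIV"
    using real_arch_simple by auto
  show "emeasure (distr unit_uniform borel (\<lambda>s. tan (pi/2 - pi * s))) {..real i} \<noteq> \<infinity>" for i
    using finite_measure.emeasure_finite[OF unit_uniform.finite_measure_distr[of "\<lambda>s. tan (pi/2 - pi * s)" borel],
        of "{..real i}"] by simp
qed (auto simp: cauchy_distribution_def borel_eq_atMost)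

lemma real_distribution_unit_uniform:
  assumes "f \<in> borel_measurable borel"
  shows "real_distribution (distr unit_uniform borel f)"
  using assms by (intro unit_uniform.real_distribution_distr) measurable

text \<open>
  The characteristic function depends on the coefficients only through their sum, so the law is that of a
  single tangent.
\<close>
lemma distr_tangent_sum_eq_cauchy:
  fixes b \<theta> :: "'i \<Rightarrow> real"
  assumes D: "finite D" "\<And>i. i \<in> D \<Longrightarrow> b i \<ge> 0" "(\<Sum>i\<in>D. b i) = 1" and n: "n > 0"
  shows "distr unit_uniform borel (\<lambda>s. \<Sum>i\<in>D. b i * tan (\<theta> i - real n * pi * s)) = cauchy_distribution 0 1"
proof -
  let ?X = "\<lambda>s. \<Sum>i\<in>D. b i * tan (\<theta> i - real n * pi * s)"
  \<comment> \<open>The comparison is with the case of one summand and one period.\<close>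
  have "char (distr unit_uniform borel ?X) = char (distr unit_uniform borel (\<lambda>s. \<Sum>i\<in>{()}. 1 * tan (pi/2 - real 1 * pi * s)))"
    by (intro ext, subst (1 2) char_tangent_sum) (use D n in auto)
  hence "distr unit_uniform borel ?X = distr unit_uniform borel (\<lambda>s. \<Sum>i\<in>{()}. 1 * tan (pi/2 - real 1 * pi * s))"
    by (intro Levy_uniqueness real_distribution_unit_uniform) auto
  also have "\<dots> = cauchy_distribution 0 1"
    using distr_tan_eq_cauchy by simp
  finally show ?thesis .
qed

text \<open>
  A large tangent means a small cosine, and \<open>sin (x - y)\<close> is small once both cosines are.
\<close>
lemma min_abs_tan_bounded:
  fixes x y r :: real
  assumes "sin (x - y) \<noteq> 0" "\<bar>tan x\<bar> \<ge> r" "\<bar>tan y\<bar> \<ge> r" "r > 0"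
  shows "r \<le> 2 / \<bar>sin (x - y)\<bar>"
proof -
  have c: "\<bar>cos z\<bar> \<le> 1 / r" if "\<bar>tan z\<bar> \<ge> r" for z
  proof -
    have nz: "cos z \<noteq> 0"
    proof
      assume "cos z = 0"
      hence "tan z = 0" by (simp add: tan_def)
      thus False using that \<open>r > 0\<close> by simp
    qed
    have "r * \<bar>cos z\<bar> \<le> \<bar>tan z\<bar> * \<bar>cos z\<bar>"
      using that by (intro mult_right_mono) auto
    also have "\<dots> = \<bar>sin z\<bar>"
      using nz by (simp add: tan_def abs_divide)
    also have "\<dots> \<le> 1" by simp
    finally show ?thesis using \<open>r > 0\<close> by (simp add: field_simps)
  qed
  have "\<bar>sin (x - y)\<bar> \<le> \<bar>sin x\<bar> * \<bar>cos y\<bar> + \<bar>cos x\<bar> * \<bar>sin y\<bar>"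
    unfolding sin_diff abs_mult[symmetric] by (rule abs_triangle_ineq4)
  also have "\<dots> \<le> 1 * (1 / r) + (1 / r) * 1"
    using assms c by (intro add_mono mult_mono) auto
  finally show ?thesis
    using assms by (simp add: field_simps)
qed

lemma tangent_sum_bounded:
  fixes b x :: "'i \<Rightarrow> real"
  assumes "finite D" "\<And>i. i \<in> D \<Longrightarrow> \<bar>tan (x i)\<bar> < r"
  shows "\<bar>\<Sum>i\<in>D. b i * tan (x i)\<bar> \<le> (\<Sum>i\<in>D. \<bar>b i\<bar>) * r"
proof -
  have "\<bar>\<Sum>i\<in>D. b i * tan (x i)\<bar> \<le> (\<Sum>i\<in>D. \<bar>b i\<bar> * \<bar>tan (x i)\<bar>)"
    using sum_abs[of "\<lambda>i. b i * tan (x i)" D] by (simp add: abs_mult)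
  also have "\<dots> \<le> (\<Sum>i\<in>D. \<bar>b i\<bar> * r)"
    using assms by (intro sum_mono mult_left_mono) (auto intro: less_imp_le)
  finally show ?thesis by (simp add: sum_distrib_right)
qed

text \<open>
  Each sum is large only near one of its poles, and the poles of the first sum are separated from those of
  the second.
\<close>
lemma tangent_sums_not_both_large:
  fixes b \<theta> :: "'i \<Rightarrow> real"
  assumes fin: "finite A" "finite B" and sin: "\<And>i j. i \<in> A \<Longrightarrow> j \<in> B \<Longrightarrow> sin (\<theta> i - \<theta> j) \<noteq> 0"
  obtains K where "K > 0"
    "\<And>x. \<not> (\<bar>\<Sum>i\<in>A. b i * tan (\<theta> i - x)\<bar> \<ge> K \<and> \<bar>\<Sum>j\<in>B. b j * tan (\<theta> j - x)\<bar> \<ge> K)"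
proof -
  define r where "r = 1 + (\<Sum>(i, j)\<in>A \<times> B. 2 / \<bar>sin (\<theta> i - \<theta> j)\<bar>)"
  have r: "2 / \<bar>sin (\<theta> i - \<theta> j)\<bar> < r" if "i \<in> A" "j \<in> B" for i j
    using member_le_sum[of "(i, j)" "A \<times> B" "\<lambda>(i, j). 2 / \<bar>sin (\<theta> i - \<theta> j)\<bar>"] that fin
    by (auto simp: r_def)
  have "r > 0"
    unfolding r_def by (intro add_pos_nonneg sum_nonneg) auto
  define K where "K = 1 + (\<Sum>i\<in>A \<union> B. \<bar>b i\<bar>) * r"
  have "(\<Sum>i\<in>A \<union> B. \<bar>b i\<bar>) \<ge> 0"
    by (intro sum_nonneg) auto
  hence "K > 0"
    using \<open>r > 0\<close> by (simp add: K_def add_pos_nonneg)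
  have large: "\<exists>i\<in>S. \<bar>tan (\<theta> i - x)\<bar> \<ge> r"
    if "S \<subseteq> A \<union> B" "\<bar>\<Sum>i\<in>S. b i * tan (\<theta> i - x)\<bar> \<ge> K" for S x
  proof (rule ccontr)
    assume *: "\<not> (\<exists>i\<in>S. \<bar>tan (\<theta> i - x)\<bar> \<ge> r)"
    have "finite S" using that(1) fin by (meson finite_UnI finite_subset)
    hence "\<bar>\<Sum>i\<in>S. b i * tan (\<theta> i - x)\<bar> \<le> (\<Sum>i\<in>S. \<bar>b i\<bar>) * r"
      using * by (intro tangent_sum_bounded) auto
    also have "\<dots> \<le> (\<Sum>i\<in>A \<union> B. \<bar>b i\<bar>) * r"
      using fin that \<open>r > 0\<close> by (intro mult_right_mono sum_mono2) auto
    finally show False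
      using that(2) by (simp add: K_def)
  qed
  show thesis
  proof (rule that[OF \<open>K > 0\<close>], safe)
    fix x assume "K \<le> \<bar>\<Sum>i\<in>A. b i * tan (\<theta> i - x)\<bar>" "K \<le> \<bar>\<Sum>j\<in>B. b j * tan (\<theta> j - x)\<bar>"
    with large[of A x] large[of B x] obtain i j where ij: "i \<in> A" "j \<in> B"
      "\<bar>tan (\<theta> i - x)\<bar> \<ge> r" "\<bar>tan (\<theta> j - x)\<bar> \<ge> r"
      by auto
    from min_abs_tan_bounded[OF _ ij(3,4) \<open>r > 0\<close>] sin[OF ij(1,2)] r[OF ij(1,2)]
    show False by simp
  qed
qed

lemma measure_tangent_sum:
  fixes b \<theta> :: "'i \<Rightarrow> real"
  assumes D: "finite D" "\<And>i. i \<in> D \<Longrightarrow> b i \<ge> 0" and B: "(\<Sum>i\<in>D. b i) > 0" and n: "n > 0"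
  shows "measure unit_uniform {s\<in>{0..1}. (\<Sum>i\<in>D. b i * tan (\<theta> i - real n * pi * s)) \<le> y} =
           1/2 + arctan (y / (\<Sum>i\<in>D. b i)) / pi"
proof -
  define B where "B = (\<Sum>i\<in>D. b i)"
  have "B > 0" using assms by (simp add: B_def)
  let ?X = "\<lambda>s. \<Sum>i\<in>D. (b i / B) * tan (\<theta> i - real n * pi * s)"
  have eq: "(\<Sum>i\<in>D. b i * tan (\<theta> i - real n * pi * s)) = B * ?X s" for s
    using \<open>B > 0\<close> by (simp add: sum_distrib_left)
  have "distr unit_uniform borel ?X = cauchy_distribution 0 1"
    using assms \<open>B > 0\<close> by (intro distr_tangent_sum_eq_cauchy) (auto simp: B_def sum_divide_distrib[symmetric])
  hence "measure (distr unit_uniform borel ?X) {..y / B} = measure (cauchy_distribution 0 1) {..y / B}"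
    by simp
  also have "\<dots> = 1/2 + arctan (y / B) / pi"
    using arctan_lbound[of "y / B"]
    by (auto simp: measure_def emeasure_standard_cauchy_atMost intro!: enn2real_ennreal simp: field_simps)
  also have "measure (distr unit_uniform borel ?X) {..y / B} = measure unit_uniform {s\<in>{0..1}. B * ?X s \<le> y}"
    using \<open>B > 0\<close> by (subst measure_distr) (auto intro!: arg_cong2[where f = measure] simp: field_simps)
  finally show ?thesis
    unfolding eq B_def[symmetric] .
qed

text \<open>
  Suppose some coefficient is negative. Split the sum as \<open>g - h\<close>, where \<open>g\<close> and \<open>h\<close> collect the positive
  and the negative coefficients and have nonnegative weights of totals \<open>BP\<close> and \<open>BN\<close>. Both are multiples of
  Cauchy variables by the previous results, with tails of order \<open>BP / (pi y)\<close> and \<open>BN / (pi y)\<close>.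
  They are never large together, so the upper tail of \<open>g - h\<close> contains the disjoint union of the upper tail of
  \<open>g\<close> and the lower tail of \<open>h\<close>, up to a bounded shift of the level. Comparison with the Cauchy tail
  \<open>1 / (pi y)\<close> gives \<open>BP + BN \<le> 1\<close>, which contradicts \<open>BP - BN = 1\<close> and \<open>BN > 0\<close>.
\<close>
lemma distr_tangent_sum_cauchy_imp_pos:
  fixes b \<theta> :: "'i \<Rightarrow> real"
  assumes D: "finite D" "\<And>i. i \<in> D \<Longrightarrow> b i \<noteq> 0" "(\<Sum>i\<in>D. b i) = 1" and n: "n > 0"
    and sin: "\<And>i j. i \<in> D \<Longrightarrow> j \<in> D \<Longrightarrow> i \<noteq> j \<Longrightarrow> sin (\<theta> i - \<theta> j) \<noteq> 0"
    and eq: "distr unit_uniform borel (\<lambda>s. \<Sum>i\<in>D. b i * tan (\<theta> i - real n * pi * s)) = cauchy_distribution 0 1"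
    and "i0 \<in> D"
  shows "b i0 > 0"
proof (rule ccontr)
  assume "\<not> b i0 > 0"
  define P where "P = {i\<in>D. b i > 0}"
  define N where "N = {i\<in>D. b i < 0}"
  have fin: "finite P" "finite N" and disj: "P \<inter> N = {}" and DPN: "D = P \<union> N"
    using D by (auto simp: P_def N_def) (meson linorder_neqE_linordered_idom)
  define BP where "BP = (\<Sum>i\<in>P. b i)"
  define BN where "BN = (\<Sum>i\<in>N. - b i)"
  define g where "g s = (\<Sum>i\<in>P. b i * tan (\<theta> i - real n * pi * s))" for s
  define h where "h s = (\<Sum>i\<in>N. (- b i) * tan (\<theta> i - real n * pi * s))" for s
  define f where "f s = (\<Sum>i\<in>D. b i * tan (\<theta> i - real n * pi * s))" for s
  have fgh: "f s = g s - h s" for s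
    unfolding f_def g_def h_def DPN using fin disj by (simp add: sum.union_disjoint sum_negf)
  have [measurable]: "f \<in> borel_measurable borel" "g \<in> borel_measurable borel" "h \<in> borel_measurable borel"
    unfolding f_def g_def h_def by measurable
  have BPN: "BP - BN = 1"
    using D(3) unfolding DPN BP_def BN_def using fin disj by (simp add: sum.union_disjoint sum_negf)
  have "i0 \<in> N"
    using \<open>i0 \<in> D\<close> \<open>\<not> b i0 > 0\<close> D(2)[of i0] by (auto simp: N_def)
  hence "BN > 0"
    unfolding BN_def using fin by (intro sum_pos) (auto simp: N_def)
  hence "BP > 0" using BPN by simp
  obtain K where K: "K > 0" "\<And>s. \<not> (\<bar>g s\<bar> \<ge> K \<and> \<bar>h s\<bar> \<ge> K)"
  proof (rule tangent_sums_not_both_large[OF fin, of \<theta> b])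
    show "sin (\<theta> i - \<theta> j) \<noteq> 0" if "i \<in> P" "j \<in> N" for i j
      using that disj by (intro sin) (auto simp: P_def N_def)
  next
    fix K assume "K > 0" and K: "\<And>x. \<not> (\<bar>\<Sum>i\<in>P. b i * tan (\<theta> i - x)\<bar> \<ge> K \<and> \<bar>\<Sum>j\<in>N. b j * tan (\<theta> j - x)\<bar> \<ge> K)"
    show thesis
      by (rule that[OF \<open>K > 0\<close>]) (use K in \<open>simp add: g_def h_def sum_negf\<close>)
  qed
  have tail: "1/2 - arctan ((y + K) / BP) / pi + (1/2 - arctan ((y + K) / BN) / pi) \<le> 1/2 - arctan y / pi"
    if "y > 0" for y
  proof -
    let ?Sf = "{s\<in>{0..1}. \<not> f s \<le> y}" and ?Sg = "{s\<in>{0..1}. \<not> g s \<le> y + K}"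
      and ?Sh = "{s\<in>{0..1}. h s \<le> - (y + K)}"
    have sets: "?Sf \<in> unit_uniform.events" "?Sg \<in> unit_uniform.events" "?Sh \<in> unit_uniform.events"
      unfolding space_unit_uniform[symmetric] by measurable
    have f: "unit_uniform.prob ?Sf = 1/2 - arctan y / pi"
    proof -
      have "unit_uniform.prob {s\<in>{0..1}. f s \<le> y} = measure (distr unit_uniform borel f) {..y}"
        by (subst measure_distr) (auto intro!: arg_cong2[where f = measure])
      also have "distr unit_uniform borel f = cauchy_distribution 0 1"
        using eq by (simp add: f_def[abs_def])
      also have "measure (cauchy_distribution 0 1) {..y} = 1/2 + arctan y / pi"
        using arctan_lbound[of y]
        by (auto simp: measure_def emeasure_standard_cauchy_atMost intro!: enn2real_ennreal simp: field_simps)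
      finally have "unit_uniform.prob {s\<in>{0..1}. f s \<le> y} = 1/2 + arctan y / pi" .
      moreover have "{s\<in>space unit_uniform. f s \<le> y} \<in> unit_uniform.events"
        by measurable
      ultimately show ?thesis
        using unit_uniform.prob_neg[of "\<lambda>s. f s \<le> y"] by simp
    qed
    have g: "unit_uniform.prob ?Sg = 1/2 - arctan ((y + K) / BP) / pi"
    proof -
      have "unit_uniform.prob {s\<in>{0..1}. g s \<le> y + K} = 1/2 + arctan ((y + K) / BP) / pi"
        unfolding g_def BP_def
        using \<open>BP > 0\<close> fin n by (intro measure_tangent_sum) (auto simp: P_def BP_def)
      moreover have "{s\<in>space unit_uniform. g s \<le> y + K} \<in> unit_uniform.events"
        by measurable
      ultimately show ?thesis
        using unit_uniform.prob_neg[of "\<lambda>s. g s \<le> y + K"] by simp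
    qed
    have "(- y - K) / BN = - ((y + K) / BN)"
      unfolding minus_divide_left by simp
    hence m: "arctan ((- y - K) / BN) = - arctan ((y + K) / BN)"
      by (simp only: arctan_minus)
    have h: "unit_uniform.prob ?Sh = 1/2 - arctan ((y + K) / BN) / pi"
      using measure_tangent_sum[where D = N and b = "\<lambda>i. - b i" and n = n and y = "- (y + K)" and \<theta> = \<theta>] \<open>BN > 0\<close> fin n m
      unfolding h_def BN_def[symmetric] by (simp add: N_def)
    have "False" if "\<not> g s \<le> y + K" "h s \<le> - (y + K)" for s
    proof -
      have "\<bar>g s\<bar> \<ge> K" "\<bar>h s\<bar> \<ge> K"
        using that \<open>y > 0\<close> \<open>K > 0\<close> by linarith+
      thus False using K(2)[of s] by blast
    qed
    hence "?Sg \<inter> ?Sh = {}" by blast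
    hence "unit_uniform.prob ?Sg + unit_uniform.prob ?Sh = unit_uniform.prob (?Sg \<union> ?Sh)"
      using sets by (intro unit_uniform.finite_measure_Union[symmetric])
    also have "\<dots> \<le> unit_uniform.prob ?Sf"
    proof (rule unit_uniform.finite_measure_mono)
      show "?Sg \<union> ?Sh \<subseteq> ?Sf"
      proof
        fix s assume "s \<in> ?Sg \<union> ?Sh"
        with K(2)[of s] that show "s \<in> ?Sf"
          by (auto simp: fgh abs_if split: if_splits)
      qed
    qed (use sets in simp)
    finally show ?thesis unfolding f g h .
  qed
  have lim1: "((\<lambda>y. y * (pi/2 - arctan ((y + K) / BP) + (pi/2 - arctan ((y + K) / BN)))) \<longlongrightarrow> BP + BN) at_top"
    using \<open>BP > 0\<close> \<open>BN > 0\<close> by real_asymp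
  have lim2: "((\<lambda>y. y * (pi/2 - arctan y)) \<longlongrightarrow> 1) at_top"
    by real_asymp
  have "BP + BN \<le> 1"
  proof (rule tendsto_le[OF trivial_limit_at_top_linorder lim2 lim1])
    show "\<forall>\<^sub>F y in at_top. y * (pi/2 - arctan ((y + K) / BP) + (pi/2 - arctan ((y + K) / BN))) \<le>
        y * (pi/2 - arctan y)"
      using eventually_gt_at_top[of 0]
    proof eventually_elim
      case (elim y)
      have "pi/2 - arctan ((y + K) / BP) + (pi/2 - arctan ((y + K) / BN)) =
         pi * (1/2 - arctan ((y + K) / BP) / pi + (1/2 - arctan ((y + K) / BN) / pi))"
        by (simp add: field_simps)
      also have "\<dots> \<le> pi * (1/2 - arctan y / pi)"
        using tail[OF elim] by (intro mult_left_mono) auto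
      also have "\<dots> = pi/2 - arctan y"
        by (simp add: field_simps)
      finally show ?case
        using elim by (intro mult_left_mono) auto
    qed
  qed
  with BPN \<open>BN > 0\<close> show False by simp
qed

theorem distr_tangent_sum_eq_cauchy_iff:
  fixes b \<theta> :: "'i \<Rightarrow> real"
  assumes "finite D" "\<And>i. i \<in> D \<Longrightarrow> b i \<noteq> 0" "(\<Sum>i\<in>D. b i) = 1" "n > 0"
    and "\<And>i j. i \<in> D \<Longrightarrow> j \<in> D \<Longrightarrow> i \<noteq> j \<Longrightarrow> sin (\<theta> i - \<theta> j) \<noteq> 0"
  shows "distr unit_uniform borel (\<lambda>s. \<Sum>i\<in>D. b i * tan (\<theta> i - real n * pi * s)) = cauchy_distribution 0 1
    \<longleftrightarrow> (\<forall>i\<in>D. b i > 0)"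
proof
  assume "distr unit_uniform borel (\<lambda>s. \<Sum>i\<in>D. b i * tan (\<theta> i - real n * pi * s)) = cauchy_distribution 0 1"
  thus "\<forall>i\<in>D. b i > 0"
    using distr_tangent_sum_cauchy_imp_pos[where b = b and \<theta> = \<theta>, OF assms] by blast
next
  assume "\<forall>i\<in>D. b i > 0"
  thus "distr unit_uniform borel (\<lambda>s. \<Sum>i\<in>D. b i * tan (\<theta> i - real n * pi * s)) = cauchy_distribution 0 1"
    using assms by (intro distr_tangent_sum_eq_cauchy) (auto intro: less_imp_le)
qed

section \<open>Rotations of frames\<close>

definition rotate_frame :: "real \<Rightarrow> (real^'n) \<times> (real^'n) \<Rightarrow> (real^'n) \<times> (real^'n)" where
  "rotate_frame x fr =
     (cos x *\<^sub>R fst fr + sin x *\<^sub>R snd fr, cos x *\<^sub>R snd fr - sin x *\<^sub>R fst fr)"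

lemma rotate_frame_add: "rotate_frame x (rotate_frame y fr) = rotate_frame (x + y) fr"
  by (simp add: rotate_frame_def cos_add sin_add algebra_simps)

lemma rotate_frame_2pi [simp]: "rotate_frame (x + 2 * pi) fr = rotate_frame x fr"
  by (simp add: rotate_frame_def)

lemma rotate_frame_0 [simp]: "rotate_frame 0 fr = fr"
  by (simp add: rotate_frame_def)

lemma orthonormal_frames_iff:
  "(u, v) \<in> orthonormal_frames \<longleftrightarrow> u \<bullet> u = 1 \<and> v \<bullet> v = 1 \<and> u \<bullet> v = 0"
  by (auto simp: orthonormal_frames_def norm_eq_1)

lemma rotate_frame_orthonormal:
  assumes "fr \<in> orthonormal_frames"
  shows "rotate_frame x fr \<in> orthonormal_frames"
proof -
  obtain u v where fr: "fr = (u, v)" by (cases fr)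
  have uv: "u \<bullet> u = 1" "v \<bullet> v = 1" "u \<bullet> v = 0" "v \<bullet> u = 0"
    using assms by (auto simp: fr orthonormal_frames_iff inner_commute)
  have "cos x * cos x + sin x * sin x = 1"
    using sin_cos_squared_add3[of x] by simp
  thus ?thesis
    unfolding fr rotate_frame_def
    by (simp add: orthonormal_frames_iff inner_add_left inner_add_right inner_diff_left inner_diff_right uv)
qed

lemma oriented_span_rotate_frame: "oriented_span (rotate_frame x fr) = oriented_span fr"
proof -
  have sub: "fst (oriented_span (rotate_frame x fr)) \<subseteq> fst (oriented_span fr) \<and>
             snd (oriented_span (rotate_frame x fr)) \<subseteq> snd (oriented_span fr)"
    for x and fr :: "(real^'n) \<times> (real^'n)"
  proof -
    obtain u v where fr: "fr = (u, v)" by (cases fr)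
    let ?u = "cos x *\<^sub>R u + sin x *\<^sub>R v" and ?v = "cos x *\<^sub>R v - sin x *\<^sub>R u"
    have "{?u, ?v} \<subseteq> span {u, v}"
      by (simp add: span_add span_diff span_scale span_base)
    hence "span {?u, ?v} \<subseteq> span {u, v}"
      by (simp add: span_minimal)
    moreover have "\<exists>\<alpha>' \<beta>' \<gamma>' \<delta>'. (\<alpha> *\<^sub>R ?u + \<beta> *\<^sub>R ?v, \<gamma> *\<^sub>R ?u + \<delta> *\<^sub>R ?v) =
        (\<alpha>' *\<^sub>R u + \<beta>' *\<^sub>R v, \<gamma>' *\<^sub>R u + \<delta>' *\<^sub>R v) \<and> \<alpha>' * \<delta>' - \<beta>' * \<gamma>' > 0"
      if "\<alpha> * \<delta> - \<beta> * \<gamma> > 0" for \<alpha> \<beta> \<gamma> \<delta>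
    proof (intro exI conjI)
      show "(\<alpha> *\<^sub>R ?u + \<beta> *\<^sub>R ?v, \<gamma> *\<^sub>R ?u + \<delta> *\<^sub>R ?v) =
        ((\<alpha> * cos x - \<beta> * sin x) *\<^sub>R u + (\<alpha> * sin x + \<beta> * cos x) *\<^sub>R v,
         (\<gamma> * cos x - \<delta> * sin x) *\<^sub>R u + (\<gamma> * sin x + \<delta> * cos x) *\<^sub>R v)"
        by (simp add: algebra_simps)
      have "(\<alpha> * cos x - \<beta> * sin x) * (\<gamma> * sin x + \<delta> * cos x) - (\<alpha> * sin x + \<beta> * cos x) * (\<gamma> * cos x - \<delta> * sin x)
          = (\<alpha> * \<delta> - \<beta> * \<gamma>) * (cos x * cos x + sin x * sin x)"
        by algebra
      thus "(\<alpha> * cos x - \<beta> * sin x) * (\<gamma> * sin x + \<delta> * cos x)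
          - (\<alpha> * sin x + \<beta> * cos x) * (\<gamma> * cos x - \<delta> * sin x) > 0"
        using that sin_cos_squared_add3[of x] by simp
    qed
    ultimately show ?thesis
      by (fastforce simp: oriented_span_def rotate_frame_def fr)
  qed
  have "rotate_frame (-x) (rotate_frame x fr) = fr"
    by (simp add: rotate_frame_add)
  with sub[of x fr] sub[of "-x" "rotate_frame x fr"] show ?thesis
    by (auto intro: prod_eqI)
qed

text \<open>
  The change of basis is orthogonal with positive determinant, hence a rotation.
\<close>
lemma oriented_span_eq_imp_rotate_frame:
  assumes "fr \<in> orthonormal_frames" "fr' \<in> orthonormal_frames" "oriented_span fr = oriented_span fr'"
  obtains x where "0 \<le> x" "x < 2 * pi" "fr' = rotate_frame x fr"
proof -
  obtain u v where fr: "fr = (u, v)" by (cases fr)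
  obtain u' v' where fr': "fr' = (u', v')" by (cases fr')
  have uv: "u \<bullet> u = 1" "v \<bullet> v = 1" "u \<bullet> v = 0" "v \<bullet> u = 0"
       and uv': "u' \<bullet> u' = 1" "v' \<bullet> v' = 1" "u' \<bullet> v' = 0"
    using assms by (auto simp: fr fr' orthonormal_frames_iff inner_commute)
  have "(u', v') = (1 *\<^sub>R u' + 0 *\<^sub>R v', 0 *\<^sub>R u' + 1 *\<^sub>R v') \<and> 1 * 1 - 0 * 0 > (0::real)"
    by simp
  hence "(u', v') \<in> snd (oriented_span fr')"
    unfolding oriented_span_def fr' prod.case snd_conv mem_Collect_eq
    by blast
  hence "(u', v') \<in> snd (oriented_span fr)"
    using assms(3) by simp
  then obtain \<alpha> \<beta> \<gamma> \<delta> where u': "u' = \<alpha> *\<^sub>R u + \<beta> *\<^sub>R v" and v': "v' = \<gamma> *\<^sub>R u + \<delta> *\<^sub>R v"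
    and pos: "\<alpha> * \<delta> - \<beta> * \<gamma> > 0"
    by (auto simp: oriented_span_def fr)
  have eqs: "\<alpha> * \<alpha> + \<beta> * \<beta> = 1" "\<gamma> * \<gamma> + \<delta> * \<delta> = 1" "\<alpha> * \<gamma> + \<beta> * \<delta> = 0"
    using uv' unfolding u' v' by (simp_all add: inner_add_left inner_add_right uv mult.commute)
  \<comment> \<open>The Lagrange identity forces the determinant to be a unit; orientation selects the sign.\<close>
  define d where "d = \<alpha> * \<delta> - \<beta> * \<gamma>"
  have "d * d + (\<alpha> * \<gamma> + \<beta> * \<delta>) * (\<alpha> * \<gamma> + \<beta> * \<delta>) = (\<alpha> * \<alpha> + \<beta> * \<beta>) * (\<gamma> * \<gamma> + \<delta> * \<delta>)"
    by (simp add: d_def algebra_simps)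
  hence "d * d = 1" using eqs by simp
  hence "d = 1" using pos by (auto simp: d_def square_eq_1_iff)
  have "(\<alpha> * \<alpha> + \<beta> * \<beta>) * \<gamma> = \<alpha> * (\<alpha> * \<gamma> + \<beta> * \<delta>) - \<beta> * d"
    "(\<alpha> * \<alpha> + \<beta> * \<beta>) * \<delta> = \<beta> * (\<alpha> * \<gamma> + \<beta> * \<delta>) + \<alpha> * d"
    by (simp_all add: d_def algebra_simps)
  hence gd: "\<gamma> = - \<beta>" "\<delta> = \<alpha>"
    unfolding eqs \<open>d = 1\<close> by simp_all
  have "\<alpha>\<^sup>2 + \<beta>\<^sup>2 = 1" using eqs by (simp add: power2_eq_square)
  from sincos_total_2pi[OF this] obtain x where "0 \<le> x" "x < 2 * pi" "\<alpha> = cos x" "\<beta> = sin x"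
    by blast
  thus thesis
    by (intro that[of x]) (simp_all add: fr fr' u' v' gd rotate_frame_def)
qed

lemma space_frame_space [simp]: "space frame_space = orthonormal_frames"
  by (simp add: frame_space_def space_restrict_space)

lemma measurable_frame_space_fst [measurable]: "fst \<in> frame_space \<rightarrow>\<^sub>M borel"
  unfolding frame_space_def
  by (intro measurable_restrict_space1 borel_measurable_continuous_onI continuous_intros)

lemma measurable_frame_space_snd [measurable]: "snd \<in> frame_space \<rightarrow>\<^sub>M borel"
  unfolding frame_space_def
  by (intro measurable_restrict_space1 borel_measurable_continuous_onI continuous_intros)

lemma measurable_into_frame_space:
  assumes "\<And>x. x \<in> space M \<Longrightarrow> f x \<in> orthonormal_frames"
    "(\<lambda>x. fst (f x)) \<in> M \<rightarrow>\<^sub>M borel" "(\<lambda>x. snd (f x)) \<in> M \<rightarrow>\<^sub>M borel"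
  shows "f \<in> M \<rightarrow>\<^sub>M frame_space"
proof -
  have "(\<lambda>x. (fst (f x), snd (f x))) \<in> M \<rightarrow>\<^sub>M borel"
    using assms by (intro borel_measurable_Pair)
  thus ?thesis
    unfolding frame_space_def using assms by (intro measurable_restrict_space2) auto
qed

lemma measurable_rotate_frame [measurable]: "rotate_frame x \<in> frame_space \<rightarrow>\<^sub>M frame_space"
proof (rule measurable_into_frame_space)
  show "(\<lambda>fr. fst (rotate_frame x fr)) \<in> frame_space \<rightarrow>\<^sub>M borel"
    "(\<lambda>fr. snd (rotate_frame x fr)) \<in> frame_space \<rightarrow>\<^sub>M borel"
    unfolding rotate_frame_def fst_conv snd_conv by measurable
qed (simp add: rotate_frame_orthonormal)

lemma measurable_rotate_frame_angle:
  "fr \<in> orthonormal_frames \<Longrightarrow> (\<lambda>s. rotate_frame (2 * pi * s) fr) \<in> borel \<rightarrow>\<^sub>M frame_space"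
proof (rule measurable_into_frame_space)
  show "(\<lambda>s. fst (rotate_frame (2 * pi * s) fr)) \<in> borel_measurable borel"
    "(\<lambda>s. snd (rotate_frame (2 * pi * s) fr)) \<in> borel_measurable borel"
    unfolding rotate_frame_def fst_conv snd_conv by measurable
qed (simp add: rotate_frame_orthonormal)

lemma measurable_rotate_frame_pair [measurable]:
  "(\<lambda>(fr, s). rotate_frame (2 * pi * s) fr) \<in> frame_space \<Otimes>\<^sub>M unit_uniform \<rightarrow>\<^sub>M frame_space"
proof (intro measurable_into_frame_space)
  have [measurable]: "(\<lambda>x. fst (fst x)) \<in> frame_space \<Otimes>\<^sub>M unit_uniform \<rightarrow>\<^sub>M borel"
    "(\<lambda>x. snd (fst x)) \<in> frame_space \<Otimes>\<^sub>M unit_uniform \<rightarrow>\<^sub>M borel"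
    "snd \<in> frame_space \<Otimes>\<^sub>M unit_uniform \<rightarrow>\<^sub>M borel"
    using measurable_compose[OF measurable_fst measurable_frame_space_fst]
      measurable_compose[OF measurable_fst measurable_frame_space_snd]
      measurable_compose[OF measurable_snd measurable_unit_uniform[OF measurable_ident]] by auto
  show "(\<lambda>x. fst (case x of (fr, s) \<Rightarrow> rotate_frame (2 * pi * s) fr)) \<in> borel_measurable (frame_space \<Otimes>\<^sub>M unit_uniform)"
       "(\<lambda>x. snd (case x of (fr, s) \<Rightarrow> rotate_frame (2 * pi * s) fr)) \<in> borel_measurable (frame_space \<Otimes>\<^sub>M unit_uniform)"
    unfolding rotate_frame_def case_prod_beta fst_conv snd_conv by measurable
qed (auto simp: space_pair_measure rotate_frame_orthonormal)

section \<open>The law along the rotation orbit of a frame\<close>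

lemma nn_integral_unit_uniform:
  "f \<in> borel_measurable borel \<Longrightarrow> (\<integral>\<^sup>+s. f s \<partial>unit_uniform) = (\<integral>\<^sup>+s. f s * indicator {0..1} s \<partial>lborel)"
  unfolding unit_uniform_def by (subst nn_integral_restrict_space) (auto simp: mult.commute)

text \<open>
  The part of the shifted interval beyond \<open>1\<close> is moved back by one period.
\<close>
lemma nn_integral_unit_uniform_shift:
  fixes f :: "real \<Rightarrow> ennreal"
  assumes [measurable]: "f \<in> borel_measurable borel" and per: "\<And>s. f (s + 1) = f s"
    and x: "0 \<le> x" "x < 1"
  shows "(\<integral>\<^sup>+s. f (s + x) \<partial>unit_uniform) = (\<integral>\<^sup>+s. f s \<partial>unit_uniform)"
proof -
  have AE: "AE s in lborel. s \<noteq> y" for y :: real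
    by (rule AE_lborel_singleton)
  have "(\<integral>\<^sup>+s. f (s + x) \<partial>unit_uniform) = (\<integral>\<^sup>+s. f (s + x) * indicator {0..1} s \<partial>lborel)"
    by (rule nn_integral_unit_uniform) simp
  also have "\<dots> = (\<integral>\<^sup>+s. f s * indicator {x..1+x} s \<partial>lborel)"
    by (subst (2) nn_integral_real_affine[where c = 1 and t = x])
       (auto intro!: nn_integral_cong simp: add.commute split: split_indicator)
  also have "\<dots> = (\<integral>\<^sup>+s. f s * indicator {x<..1} s + f s * indicator {1<..1+x} s \<partial>lborel)"
    by (rule nn_integral_cong_AE) (use AE[of x] x in \<open>auto elim!: eventually_mono split: split_indicator\<close>)
  also have "\<dots> = (\<integral>\<^sup>+s. f s * indicator {x<..1} s \<partial>lborel) + (\<integral>\<^sup>+s. f s * indicator {1<..1+x} s \<partial>lborel)"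
    by (rule nn_integral_add) auto
  also have "(\<integral>\<^sup>+s. f s * indicator {1<..1+x} s \<partial>lborel) = (\<integral>\<^sup>+s. f s * indicator {0<..x} s \<partial>lborel)"
    by (subst nn_integral_real_affine[where c = 1 and t = 1])
       (auto intro!: nn_integral_cong simp: per add.commute[of 1] split: split_indicator)
  also have "(\<integral>\<^sup>+s. f s * indicator {x<..1} s \<partial>lborel) + \<dots> =
      (\<integral>\<^sup>+s. f s * indicator {x<..1} s + f s * indicator {0<..x} s \<partial>lborel)"
    by (rule nn_integral_add[symmetric]) auto
  also have "\<dots> = (\<integral>\<^sup>+s. f s * indicator {0..1} s \<partial>lborel)"
    by (rule nn_integral_cong_AE) (use AE[of 0] x in \<open>auto elim!: eventually_mono split: split_indicator\<close>)
  also have "\<dots> = (\<integral>\<^sup>+s. f s \<partial>unit_uniform)"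
    by (rule nn_integral_unit_uniform[symmetric]) simp
  finally show ?thesis .
qed

lemma distr_unit_uniform_shift:
  assumes f [measurable]: "f \<in> borel \<rightarrow>\<^sub>M N" and per: "\<And>s. f (s + 1) = f s"
    and x: "0 \<le> x" "x < 1"
  shows "distr unit_uniform N (\<lambda>s. f (s + x)) = distr unit_uniform N f"
proof (rule measure_eqI)
  fix A assume "A \<in> sets (distr unit_uniform N (\<lambda>s. f (s + x)))"
  hence [measurable]: "A \<in> sets N" by simp
  have "emeasure (distr unit_uniform N (\<lambda>s. f (s + x))) A = (\<integral>\<^sup>+y. indicator A y \<partial>distr unit_uniform N (\<lambda>s. f (s + x)))"
    by simp
  also have "\<dots> = (\<integral>\<^sup>+s. indicator A (f (s + x)) \<partial>unit_uniform)"
    by (subst nn_integral_distr) auto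
  also have "\<dots> = (\<integral>\<^sup>+s. indicator A (f s) \<partial>unit_uniform)"
    using x by (intro nn_integral_unit_uniform_shift) (auto simp: per)
  also have "\<dots> = (\<integral>\<^sup>+y. indicator A y \<partial>distr unit_uniform N f)"
    by (subst nn_integral_distr) auto
  also have "\<dots> = emeasure (distr unit_uniform N f) A"
    by simp
  finally show "emeasure (distr unit_uniform N (\<lambda>s. f (s + x))) A = emeasure (distr unit_uniform N f) A" .
qed simp

definition orbit_law :: "'x measure \<Rightarrow> ((real^'n) \<times> (real^'n) \<Rightarrow> 'x) \<Rightarrow> (real^'n) \<times> (real^'n) \<Rightarrow> 'x measure" where
  "orbit_law N f fr = distr unit_uniform N (\<lambda>s. f (rotate_frame (2 * pi * s) fr))"

text \<open>
  Rotating the starting frame shifts the uniform phase. Hence the law along the orbit depends only on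
  the oriented plane.
\<close>
lemma orbit_law_rotate_frame:
  assumes f: "f \<in> frame_space \<rightarrow>\<^sub>M N" and "fr \<in> orthonormal_frames" "0 \<le> x" "x < 2 * pi"
  shows "orbit_law N f (rotate_frame x fr) = orbit_law N f fr"
proof -
  define g where "g s = f (rotate_frame (2 * pi * s) fr)" for s
  have [measurable]: "g \<in> borel \<rightarrow>\<^sub>M N"
    unfolding g_def using measurable_compose[OF measurable_rotate_frame_angle f] assms by simp
  have "g (s + 1) = g s" for s
    using rotate_frame_2pi[of "2 * pi * s" fr] by (simp add: g_def algebra_simps)
  moreover have "0 \<le> x / (2 * pi)" "x / (2 * pi) < 1"
    using assms by (simp_all add: field_simps)
  ultimately have "distr unit_uniform N (\<lambda>s. g (s + x / (2 * pi))) = distr unit_uniform N g"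
    by (intro distr_unit_uniform_shift) auto
  moreover have "g (s + x / (2 * pi)) = f (rotate_frame (2 * pi * s) (rotate_frame x fr))" for s
    by (simp add: g_def rotate_frame_add distrib_left)
  ultimately show ?thesis
    unfolding orbit_law_def by (simp add: g_def[abs_def])
qed

lemma orbit_law_cong:
  assumes "f \<in> frame_space \<rightarrow>\<^sub>M N" "fr \<in> orthonormal_frames" "fr' \<in> orthonormal_frames"
    "oriented_span fr = oriented_span fr'"
  shows "orbit_law N f fr' = orbit_law N f fr"
  using oriented_span_eq_imp_rotate_frame[OF assms(2-4)] orbit_law_rotate_frame[OF assms(1,2)] by metis

text \<open>
  An arbitrary frame of the plane serves as the starting point of the orbit.
\<close>
definition plane_law ::
    "'x measure \<Rightarrow> ((real^'n) \<times> (real^'n) \<Rightarrow> 'x) \<Rightarrow> 'n oriented_plane \<Rightarrow> 'x measure" where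
  "plane_law N f p = orbit_law N f (SOME fr. fr \<in> orthonormal_frames \<and> oriented_span fr = p)"

lemma plane_law_oriented_span:
  assumes "f \<in> frame_space \<rightarrow>\<^sub>M N" "fr \<in> orthonormal_frames"
  shows "plane_law N f (oriented_span fr) = orbit_law N f fr"
proof -
  have "(SOME fr'. fr' \<in> orthonormal_frames \<and> oriented_span fr' = oriented_span fr) \<in> orthonormal_frames \<and>
     oriented_span (SOME fr'. fr' \<in> orthonormal_frames \<and> oriented_span fr' = oriented_span fr) = oriented_span fr"
    using assms by (intro someI[of "\<lambda>fr'. fr' \<in> orthonormal_frames \<and> oriented_span fr' = oriented_span fr"]) auto
  thus ?thesis
    unfolding plane_law_def using assms by (intro orbit_law_cong) auto
qed

lemma space_oriented_grassmannian [simp]: "space oriented_grassmannian = oriented_planes"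
  by (simp add: oriented_grassmannian_def space_measure_of_conv)

lemma measurable_oriented_span [measurable]: "oriented_span \<in> frame_space \<rightarrow>\<^sub>M oriented_grassmannian"
  unfolding oriented_grassmannian_def
  by (rule measurable_measure_of) (auto simp: oriented_planes_def)

text \<open>
  The universal property of the quotient \<open>\<sigma>\<close>-algebra.
\<close>
lemma measurable_from_oriented_grassmannian:
  fixes g :: "'n::finite oriented_plane \<Rightarrow> 'x"
  assumes "(\<lambda>fr. g (oriented_span fr)) \<in> frame_space \<rightarrow>\<^sub>M N"
  shows "g \<in> oriented_grassmannian \<rightarrow>\<^sub>M N"
proof (rule measurableI)
  fix p :: "'n oriented_plane" assume "p \<in> space oriented_grassmannian"
  thus "g p \<in> space N"
    using measurable_space[OF assms] by (auto simp: oriented_planes_def)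
next
  fix A assume "A \<in> sets N"
  have "oriented_span -` (g -` A \<inter> oriented_planes) \<inter> orthonormal_frames =
      (\<lambda>fr. g (oriented_span fr)) -` A \<inter> space frame_space"
    by (auto simp: oriented_planes_def)
  also have "\<dots> \<in> sets frame_space"
    using assms \<open>A \<in> sets N\<close> by (rule measurable_sets)
  finally show "g -` A \<inter> space oriented_grassmannian \<in> sets (oriented_grassmannian :: 'n oriented_plane measure)"
    unfolding space_oriented_grassmannian
    by (subst oriented_grassmannian_def) (auto intro!: in_measure_of)
qed

lemma measurable_orbit_law:
  assumes f: "f \<in> frame_space \<rightarrow>\<^sub>M N"
  shows "orbit_law N f \<in> frame_space \<rightarrow>\<^sub>M prob_algebra N"
  unfolding orbit_law_def[abs_def]
proof (rule measurable_distr_prob_space2)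
  show "(\<lambda>_. unit_uniform) \<in> frame_space \<rightarrow>\<^sub>M prob_algebra unit_uniform"
    by (simp add: space_prob_algebra prob_space_unit_uniform)
  show "(\<lambda>(fr, s). f (rotate_frame (2 * pi * s) fr)) \<in> frame_space \<Otimes>\<^sub>M unit_uniform \<rightarrow>\<^sub>M N"
    using measurable_compose[OF measurable_rotate_frame_pair f] by (simp add: case_prod_beta')
qed

lemma measurable_plane_law:
  assumes f: "f \<in> frame_space \<rightarrow>\<^sub>M N"
  shows "plane_law N f \<in> oriented_grassmannian \<rightarrow>\<^sub>M prob_algebra N"
proof (rule measurable_from_oriented_grassmannian)
  show "(\<lambda>fr. plane_law N f (oriented_span fr)) \<in> frame_space \<rightarrow>\<^sub>M prob_algebra N"
    using measurable_orbit_law[OF f]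
    by (subst measurable_cong[where g = "orbit_law N f"]) (auto simp: plane_law_oriented_span[OF f])
qed

section \<open>Invariance of the law of a Haar two-frame\<close>

lemma haar_orthogonal_space:
  assumes "haar_orthogonal \<nu>"
  shows "space \<nu> = orthogonal_group"
proof -
  have "sets \<nu> = sets (restrict_space borel orthogonal_group)"
    using assms by (simp add: haar_orthogonal_def)
  from sets_eq_imp_space_eq[OF this] show ?thesis
    by (simp add: space_restrict_space)
qed

lemma haar_orthogonal_measurable:
  assumes "haar_orthogonal \<nu>" "f \<in> borel \<rightarrow>\<^sub>M N"
  shows "f \<in> \<nu> \<rightarrow>\<^sub>M N"
proof -
  have "sets \<nu> = sets (restrict_space borel orthogonal_group)"
    using assms(1) by (simp add: haar_orthogonal_def)
  thus ?thesis
    using measurable_cong_sets[OF _ refl, of \<nu> "restrict_space borel orthogonal_group" N]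
      measurable_restrict_space1[OF assms(2)] by blast
qed

lemma haar_orthogonal_measurable_self:
  assumes "haar_orthogonal \<nu>" "continuous_on UNIV f" "\<And>A. A \<in> orthogonal_group \<Longrightarrow> f A \<in> orthogonal_group"
  shows "f \<in> \<nu> \<rightarrow>\<^sub>M \<nu>"
proof -
  have "f \<in> \<nu> \<rightarrow>\<^sub>M restrict_space borel orthogonal_group"
  proof (rule measurable_restrict_space2)
    show "f \<in> space \<nu> \<rightarrow> orthogonal_group"
      using assms(3) by (intro funcsetI) (simp only: haar_orthogonal_space[OF assms(1)])
    show "f \<in> \<nu> \<rightarrow>\<^sub>M borel"
      by (intro haar_orthogonal_measurable[OF assms(1)] borel_measurable_continuous_onI assms(2))
  qed
  moreover have "sets \<nu> = sets (restrict_space borel orthogonal_group)"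
    using assms(1) by (simp add: haar_orthogonal_def)
  ultimately show ?thesis
    using measurable_cong_sets[OF refl, of \<nu> "restrict_space borel orthogonal_group" \<nu>] by blast
qed

lemma continuous_on_matrix_mult_left: "continuous_on UNIV (\<lambda>A::real^'n^'n. Q ** A)"
  unfolding matrix_matrix_mult_def by (intro continuous_intros)

lemma continuous_on_matrix_mult_right: "continuous_on UNIV (\<lambda>A::real^'n^'n. A ** Q)"
  unfolding matrix_matrix_mult_def by (intro continuous_intros)

lemma measurable_columns:
  fixes \<nu> :: "(real^'n^'n) measure"
  assumes "haar_orthogonal \<nu>" "i \<noteq> j"
  shows "(\<lambda>A. (column i A, column j A)) \<in> \<nu> \<rightarrow>\<^sub>M frame_space"
proof (rule measurable_into_frame_space)
  have "column l \<in> \<nu> \<rightarrow>\<^sub>M borel" for l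
    unfolding column_def
    by (intro haar_orthogonal_measurable[OF assms(1)] borel_measurable_continuous_onI continuous_intros)
  thus "(\<lambda>A. fst (column i A, column j A)) \<in> \<nu> \<rightarrow>\<^sub>M borel" "(\<lambda>A. snd (column i A, column j A)) \<in> \<nu> \<rightarrow>\<^sub>M borel"
    by simp_all
  fix A assume "A \<in> space \<nu>"
  hence "orthogonal_matrix A"
    by (simp add: haar_orthogonal_space[OF assms(1)] orthogonal_group_def)
  thus "(column i A, column j A) \<in> orthonormal_frames"
    using assms(2) by (auto simp: orthogonal_matrix_orthonormal_columns orthonormal_frames_def orthogonal_def)
qed

text \<open>
  The matrix that acts from the right on the columns \<open>i\<close> and \<open>j\<close> by a rotation through the angle \<open>x\<close> and
  leaves the other columns alone.
\<close>
definition plane_rotation :: "'n \<Rightarrow> 'n \<Rightarrow> real \<Rightarrow> real^'n^'n" where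
  "plane_rotation i j x = (\<chi> r s.
     if s = i then cos x * axis i 1 $ r + sin x * axis j 1 $ r
     else if s = j then cos x * axis j 1 $ r - sin x * axis i 1 $ r
     else axis s 1 $ r)"

lemma column_plane_rotation:
  "column s (plane_rotation i j x) =
     (if s = i then cos x *\<^sub>R axis i 1 + sin x *\<^sub>R axis j 1
      else if s = j then cos x *\<^sub>R axis j 1 - sin x *\<^sub>R axis i 1
      else axis s 1)"
  by (auto simp: column_def plane_rotation_def vec_eq_iff)

lemma column_matrix_mult: "column s (A ** B) = A *v column s B"
  by (simp add: column_def matrix_matrix_mult_def matrix_vector_mult_def vec_eq_iff)

lemma orthogonal_plane_rotation:
  fixes i j :: "'n::finite"
  assumes "i \<noteq> j"
  shows "plane_rotation i j x \<in> orthogonal_group"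
proof -
  have cs: "cos x * cos x + sin x * sin x = 1"
    using sin_cos_squared_add3[of x] by simp
  have ax: "axis r (1::real) \<bullet> axis s 1 = (if r = s then 1 else 0)" for r s :: 'n
    by (simp add: inner_axis_axis)
  show ?thesis
    unfolding orthogonal_group_def mem_Collect_eq orthogonal_matrix_orthonormal_columns
  proof (intro conjI allI impI)
    show "norm (column s (plane_rotation i j x)) = 1" for s
      using assms cs
      by (auto simp: norm_eq_1 column_plane_rotation inner_add_left inner_add_right inner_diff_left inner_diff_right ax)
    show "orthogonal (column r (plane_rotation i j x)) (column s (plane_rotation i j x))" if "r \<noteq> s" for r s
      using assms cs that
      by (auto simp: orthogonal_def column_plane_rotation inner_add_left inner_add_right inner_diff_left inner_diff_right ax)
  qed
qed

lemma columns_mult_plane_rotation: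
  assumes "i \<noteq> j"
  shows "(column i (A ** plane_rotation i j x), column j (A ** plane_rotation i j x)) =
           rotate_frame x (column i A, column j A)"
  using assms
  by (simp add: column_matrix_mult column_plane_rotation rotate_frame_def matrix_vector_right_distrib
      matrix_vector_mult_diff_distrib matrix_vector_mult_scaleR matrix_vector_mult_basis)

lemma haar_two_frame_measurable:
  assumes "haar_two_frame M U V"
  shows "(\<lambda>\<omega>. (U \<omega>, V \<omega>)) \<in> M \<rightarrow>\<^sub>M frame_space"
  using assms by (simp add: haar_two_frame_def)

text \<open>
  Every transformation of frames that is induced by a left or a right translation of the orthogonal group
  preserves the law of the frame. Right translations rotate the frame within its plane; left translations
  move the plane.
\<close>
lemma haar_two_frame_invariant:
  assumes M: "haar_two_frame M U V" and g: "g \<in> frame_space \<rightarrow>\<^sub>M frame_space"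
    and h: "\<And>i j. i \<noteq> j \<Longrightarrow> \<exists>Q\<in>orthogonal_group.
      (\<forall>A. g (column i A, column j A) = (column i (Q ** A), column j (Q ** A))) \<or>
      (\<forall>A. g (column i A, column j A) = (column i (A ** Q), column j (A ** Q)))"
  shows "distr M frame_space (\<lambda>\<omega>. g (U \<omega>, V \<omega>)) = distr M frame_space (\<lambda>\<omega>. (U \<omega>, V \<omega>))"
proof -
  from M obtain \<nu> i j where \<nu>: "haar_orthogonal \<nu>" and ij: "i \<noteq> j"
    and law: "distr M frame_space (\<lambda>\<omega>. (U \<omega>, V \<omega>)) = distr \<nu> frame_space (\<lambda>A. (column i A, column j A))"
    by (auto simp: haar_two_frame_def)
  note [measurable] = g haar_two_frame_measurable[OF M] measurable_columns[OF \<nu> ij]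
  from h[OF ij] obtain Q T where Q: "Q \<in> orthogonal_group" and T: "T = (\<lambda>A. Q ** A) \<or> T = (\<lambda>A. A ** Q)"
    and gT: "\<And>A. g (column i A, column j A) = (column i (T A), column j (T A))"
    by metis
  have T_meas [measurable]: "T \<in> \<nu> \<rightarrow>\<^sub>M \<nu>"
    using T Q by (intro haar_orthogonal_measurable_self[OF \<nu>])
      (auto simp: continuous_on_matrix_mult_left continuous_on_matrix_mult_right orthogonal_group_def orthogonal_matrix_mul)
  have inv: "distr \<nu> \<nu> T = \<nu>"
    using \<nu> Q T by (auto simp: haar_orthogonal_def)
  have "distr M frame_space (\<lambda>\<omega>. g (U \<omega>, V \<omega>)) = distr (distr M frame_space (\<lambda>\<omega>. (U \<omega>, V \<omega>))) frame_space g"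
    by (subst distr_distr) (auto simp: o_def)
  also have "\<dots> = distr \<nu> frame_space (\<lambda>A. g (column i A, column j A))"
    unfolding law by (subst distr_distr) (auto simp: o_def)
  also have "\<dots> = distr (distr \<nu> \<nu> T) frame_space (\<lambda>A. (column i A, column j A))"
    unfolding gT by (subst distr_distr) (auto simp: o_def)
  also have "\<dots> = distr M frame_space (\<lambda>\<omega>. (U \<omega>, V \<omega>))"
    unfolding inv law ..
  finally show ?thesis .
qed

lemma haar_two_frame_rotate:
  assumes "haar_two_frame M U V"
  shows "distr M frame_space (\<lambda>\<omega>. rotate_frame x (U \<omega>, V \<omega>)) = distr M frame_space (\<lambda>\<omega>. (U \<omega>, V \<omega>))"
proof (rule haar_two_frame_invariant[OF assms measurable_rotate_frame])
  fix i j :: 'b assume "i \<noteq> j"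
  thus "\<exists>Q\<in>orthogonal_group.
      (\<forall>A. rotate_frame x (column i A, column j A) = (column i (Q ** A), column j (Q ** A))) \<or>
      (\<forall>A. rotate_frame x (column i A, column j A) = (column i (A ** Q), column j (A ** Q)))"
    by (intro bexI[of _ "plane_rotation i j x"] disjI2) (auto simp: columns_mult_plane_rotation orthogonal_plane_rotation)
qed

lemma haar_two_frame_orthogonal_transformation:
  fixes g :: "real^'n \<Rightarrow> real^'n"
  assumes M: "haar_two_frame M U V" and g: "orthogonal_transformation g"
  shows "distr M frame_space (\<lambda>\<omega>. (g (U \<omega>), g (V \<omega>))) = distr M frame_space (\<lambda>\<omega>. (U \<omega>, V \<omega>))"
proof -
  have lin: "linear g" and Q: "matrix g \<in> orthogonal_group"
    using g by (auto simp: orthogonal_transformation_matrix orthogonal_group_def)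
  have gQ: "g x = matrix g *v x" for x
    using lin by simp
  have [measurable]: "g \<in> borel_measurable borel"
    using lin by (intro borel_measurable_continuous_onI linear_continuous_on) (simp add: linear_linear)
  let ?g = "\<lambda>fr. (g (fst fr), g (snd fr))"
  have "distr M frame_space (\<lambda>\<omega>. ?g (U \<omega>, V \<omega>)) = distr M frame_space (\<lambda>\<omega>. (U \<omega>, V \<omega>))"
  proof (rule haar_two_frame_invariant[OF M])
    show "?g \<in> frame_space \<rightarrow>\<^sub>M frame_space"
      using g by (intro measurable_into_frame_space)
        (auto simp: orthonormal_frames_def orthogonal_transformation_def orthogonal_transformation_norm[OF g])
    show "\<exists>Q\<in>orthogonal_group.
      (\<forall>A. ?g (column i A, column j A) = (column i (Q ** A), column j (Q ** A))) \<or>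
      (\<forall>A. ?g (column i A, column j A) = (column i (A ** Q), column j (A ** Q)))" for i j
      using Q by (intro bexI[of _ "matrix g"] disjI1) (auto simp: column_matrix_mult gQ[symmetric])
  qed
  thus ?thesis by simp
qed

section \<open>The conditional law given the plane\<close>

text \<open>
  For each fixed angle, rotating the frame within its plane changes neither its law nor the plane. The
  probability on the left-hand side of the defining identity therefore stays the same when the frame is rotated
  and the angle is averaged; exchanging the two integrals turns it into the integral of the law along the
  orbit.
\<close>
lemma regular_conditional_law_orbit:
  fixes U V :: "'w \<Rightarrow> real^'n"
  assumes M: "haar_two_frame M U V" and f: "f \<in> frame_space \<rightarrow>\<^sub>M N"
  shows "regular_conditional_law M (\<lambda>\<omega>. f (U \<omega>, V \<omega>)) N (\<lambda>\<omega>. oriented_span (U \<omega>, V \<omega>))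
           oriented_grassmannian (plane_law N f)"
  unfolding regular_conditional_law_def
proof (intro conjI ballI measurable_plane_law[OF f])
  interpret prob_space M using M by (simp add: haar_two_frame_def)
  note UV [measurable] = haar_two_frame_measurable[OF M]
  note [measurable] = f
  define \<mu> where "\<mu> = distr M frame_space (\<lambda>\<omega>. (U \<omega>, V \<omega>))"
  interpret \<mu>: prob_space \<mu> unfolding \<mu>_def by (rule prob_space_distr) measurable
  have sets_\<mu> [measurable_cong]: "sets \<mu> = sets frame_space"
    by (simp add: \<mu>_def)
  interpret pair_sigma_finite unit_uniform \<mu> ..
  fix A :: "'n oriented_plane set" and B assume A [measurable]: "A \<in> sets oriented_grassmannian" and B [measurable]: "B \<in> sets N"
  define \<phi> :: "(real^'n) \<times> (real^'n) \<Rightarrow> ennreal" where "\<phi> fr = indicator A (oriented_span fr) * indicator B (f fr)" for fr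
  have [measurable]: "\<phi> \<in> borel_measurable frame_space"
    unfolding \<phi>_def by measurable
  have "emeasure M {\<omega>\<in>space M. oriented_span (U \<omega>, V \<omega>) \<in> A \<and> f (U \<omega>, V \<omega>) \<in> B} =
      (\<integral>\<^sup>+\<omega>. indicator {\<omega>\<in>space M. oriented_span (U \<omega>, V \<omega>) \<in> A \<and> f (U \<omega>, V \<omega>) \<in> B} \<omega> \<partial>M)"
    by (rule nn_integral_indicator[symmetric]) measurable
  also have "\<dots> = (\<integral>\<^sup>+\<omega>. \<phi> (U \<omega>, V \<omega>) \<partial>M)"
    by (rule nn_integral_cong) (auto simp: \<phi>_def split: split_indicator)
  also have "\<dots> = (\<integral>\<^sup>+fr. \<phi> fr \<partial>\<mu>)"
    unfolding \<mu>_def by (rule nn_integral_distr[symmetric]) measurable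
  also have "\<dots> = (\<integral>\<^sup>+s. (\<integral>\<^sup>+fr. \<phi> fr \<partial>\<mu>) \<partial>unit_uniform)"
    using unit_uniform.emeasure_space_1 by simp
  also have "\<dots> = (\<integral>\<^sup>+s. (\<integral>\<^sup>+fr. \<phi> (rotate_frame (2 * pi * s) fr) \<partial>\<mu>) \<partial>unit_uniform)"
  proof (rule nn_integral_cong)
    fix s
    have "(\<integral>\<^sup>+fr. \<phi> (rotate_frame (2 * pi * s) fr) \<partial>\<mu>) =
        (\<integral>\<^sup>+\<omega>. \<phi> (rotate_frame (2 * pi * s) (U \<omega>, V \<omega>)) \<partial>M)"
      unfolding \<mu>_def by (rule nn_integral_distr) measurable
    also have "\<dots> = (\<integral>\<^sup>+fr. \<phi> fr \<partial>distr M frame_space (\<lambda>\<omega>. rotate_frame (2 * pi * s) (U \<omega>, V \<omega>)))"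
      by (rule nn_integral_distr[symmetric]) measurable
    also have "\<dots> = (\<integral>\<^sup>+fr. \<phi> fr \<partial>\<mu>)"
      unfolding haar_two_frame_rotate[OF M] \<mu>_def ..
    finally show "(\<integral>\<^sup>+fr. \<phi> fr \<partial>\<mu>) = (\<integral>\<^sup>+fr. \<phi> (rotate_frame (2 * pi * s) fr) \<partial>\<mu>)" ..
  qed
  also have "\<dots> = (\<integral>\<^sup>+fr. (\<integral>\<^sup>+s. \<phi> (rotate_frame (2 * pi * s) fr) \<partial>unit_uniform) \<partial>\<mu>)"
  proof (rule Fubini'[symmetric])
    have "(\<lambda>x. (snd x, fst x)) \<in> unit_uniform \<Otimes>\<^sub>M \<mu> \<rightarrow>\<^sub>M frame_space \<Otimes>\<^sub>M unit_uniform"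
      by measurable
    from measurable_compose[OF measurable_compose[OF this measurable_rotate_frame_pair] \<open>\<phi> \<in> _\<close>]
    show "(\<lambda>(s, fr). \<phi> (rotate_frame (2 * pi * s) fr)) \<in> borel_measurable (unit_uniform \<Otimes>\<^sub>M \<mu>)"
      by (simp add: case_prod_beta')
  qed
  also have "\<dots> = (\<integral>\<^sup>+fr. emeasure (plane_law N f (oriented_span fr)) B * indicator A (oriented_span fr) \<partial>\<mu>)"
  proof (rule nn_integral_cong)
    fix fr assume "fr \<in> space \<mu>"
    hence fr: "fr \<in> orthonormal_frames" by (simp add: \<mu>_def)
    have [measurable]: "(\<lambda>s. f (rotate_frame (2 * pi * s) fr)) \<in> unit_uniform \<rightarrow>\<^sub>M N"
      using measurable_compose[OF measurable_rotate_frame_angle[OF fr] f] by measurable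
    \<comment> \<open>The plane does not notice the rotation, so its indicator leaves the integral.\<close>
    have "(\<integral>\<^sup>+s. \<phi> (rotate_frame (2 * pi * s) fr) \<partial>unit_uniform) =
      (\<integral>\<^sup>+s. indicator A (oriented_span fr) * indicator B (f (rotate_frame (2 * pi * s) fr)) \<partial>unit_uniform)"
      by (simp add: \<phi>_def oriented_span_rotate_frame)
    also have "\<dots> = indicator A (oriented_span fr) * (\<integral>\<^sup>+s. indicator B (f (rotate_frame (2 * pi * s) fr)) \<partial>unit_uniform)"
      by (rule nn_integral_cmult) measurable
    also have "(\<integral>\<^sup>+s. indicator B (f (rotate_frame (2 * pi * s) fr)) \<partial>unit_uniform) = (\<integral>\<^sup>+y. indicator B y \<partial>orbit_law N f fr)"
      unfolding orbit_law_def by (rule nn_integral_distr[symmetric]) measurable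
    also have "\<dots> = emeasure (orbit_law N f fr) B"
      by (rule nn_integral_indicator) (simp add: orbit_law_def)
    finally show "(\<integral>\<^sup>+s. \<phi> (rotate_frame (2 * pi * s) fr) \<partial>unit_uniform) =
        emeasure (plane_law N f (oriented_span fr)) B * indicator A (oriented_span fr)"
      by (simp add: plane_law_oriented_span[OF f fr] mult.commute)
  qed
  also have "\<dots> = (\<integral>\<^sup>+\<omega>. emeasure (plane_law N f (oriented_span (U \<omega>, V \<omega>))) B * indicator A (oriented_span (U \<omega>, V \<omega>)) \<partial>M)"
  proof -
    have [measurable]: "(\<lambda>p. emeasure (plane_law N f p) B) \<in> borel_measurable oriented_grassmannian"
      using measurable_prob_algebraD[OF measurable_plane_law[OF f]] B
      by (rule measurable_emeasure_kernel)
    show ?thesis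
      unfolding \<mu>_def by (rule nn_integral_distr) measurable
  qed
  finally show "emeasure M {\<omega>\<in>space M. oriented_span (U \<omega>, V \<omega>) \<in> A \<and> f (U \<omega>, V \<omega>) \<in> B} =
    (\<integral>\<^sup>+\<omega>. emeasure (plane_law N f (oriented_span (U \<omega>, V \<omega>))) B * indicator A (oriented_span (U \<omega>, V \<omega>)) \<partial>M)" .
qed

text \<open>
  For a fixed Borel set two versions agree almost everywhere, since they have the same integrals over
  every event of the conditioning variable. Countably many
  half-lines with rational endpoint determine the law, because distribution functions are right-continuous.
\<close>
lemma regular_conditional_law_unique:
  fixes X :: "'w \<Rightarrow> real"
  assumes "prob_space M" and Y [measurable]: "Y \<in> M \<rightarrow>\<^sub>M G"
    and K: "regular_conditional_law M X borel Y G K"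
    and K': "regular_conditional_law M X borel Y G K'"
  shows "AE y in distr M G Y. K y = K' y"
proof -
  interpret prob_space M by fact
  interpret Y: prob_space "distr M G Y" by (rule prob_space_distr) fact
  have kernel: "Q \<in> G \<rightarrow>\<^sub>M prob_algebra borel" "Q \<in> G \<rightarrow>\<^sub>M subprob_algebra borel"
    if "regular_conditional_law M X borel Y G Q" for Q
    using that by (auto simp: regular_conditional_law_def intro: measurable_prob_algebraD)
  have meas: "(\<lambda>y. emeasure (Q y) B) \<in> borel_measurable G"
    if "regular_conditional_law M X borel Y G Q" "B \<in> sets borel" for Q B
    using kernel(2)[OF that(1)] that(2) by (rule measurable_emeasure_kernel)
  have AE_eq: "AE y in distr M G Y. emeasure (K y) B = emeasure (K' y) B" if B: "B \<in> sets borel" for B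
  proof (rule Y.density_unique_finite_measure)
    fix A assume "A \<in> sets (distr M G Y)"
    hence A [measurable]: "A \<in> sets G" by simp
    have "(\<integral>\<^sup>+y. emeasure (Q y) B * indicator A y \<partial>distr M G Y) =
        emeasure M {\<omega>\<in>space M. Y \<omega> \<in> A \<and> X \<omega> \<in> B}"
      if Q: "regular_conditional_law M X borel Y G Q" for Q
    proof -
      note [measurable] = meas[OF Q B]
      have "(\<integral>\<^sup>+y. emeasure (Q y) B * indicator A y \<partial>distr M G Y) =
          (\<integral>\<^sup>+\<omega>. emeasure (Q (Y \<omega>)) B * indicator A (Y \<omega>) \<partial>M)"
        by (rule nn_integral_distr) measurable
      thus ?thesis
        using Q A B by (auto simp: regular_conditional_law_def)
    qed
    from this[OF K] this[OF K']
    show "(\<integral>\<^sup>+y. emeasure (K y) B * indicator A y \<partial>distr M G Y) =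
        (\<integral>\<^sup>+y. emeasure (K' y) B * indicator A y \<partial>distr M G Y)" by simp
  qed (use meas K K' B in auto)
  have "AE y in distr M G Y. \<forall>q::rat. emeasure (K y) {..of_rat q} = emeasure (K' y) {..of_rat q}"
    unfolding AE_all_countable by (auto intro: AE_eq)
  moreover have "AE y in distr M G Y. y \<in> space G"
    using AE_space[of "distr M G Y"] by simp
  ultimately show ?thesis
  proof eventually_elim
    case (elim y)
    have distribution: "real_distribution (Q y)" if "regular_conditional_law M X borel Y G Q" for Q
    proof -
      have "Q y \<in> space (prob_algebra borel)"
        using measurable_space[OF kernel(1)[OF that] elim(2)] .
      thus ?thesis
        by (auto simp: space_prob_algebra real_distribution_def real_distribution_axioms_def sets_eq_imp_space_eq)
    qed
    interpret K: real_distribution "K y" by (rule distribution[OF K])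
    interpret K': real_distribution "K' y" by (rule distribution[OF K'])
    have rat: "cdf (K y) (of_rat q) = cdf (K' y) (of_rat q)" for q
      using elim(1) by (simp add: cdf_def measure_def)
    have "cdf (K y) = cdf (K' y)"
    proof
      fix x
      define r where "r n = (SOME q::rat. x < of_rat q \<and> of_rat q < x + 1 / (real n + 1))" for n
      have r: "x < of_rat (r n)" "of_rat (r n) < x + 1 / (real n + 1)" for n
      proof -
        have "\<exists>q::rat. x < of_rat q \<and> of_rat q < x + 1 / (real n + 1)"
          by (rule of_rat_dense) simp
        from someI_ex[OF this] show "x < of_rat (r n)" "of_rat (r n) < x + 1 / (real n + 1)"
          by (auto simp: r_def)
      qed
      have "(\<lambda>n. of_rat (r n)) \<longlonglongrightarrow> x"
      proof (rule tendsto_sandwich[of "\<lambda>_. x" _ _ "\<lambda>n. x + 1 / (real n + 1)"])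
        show "(\<lambda>n. x + 1 / (real n + 1)) \<longlonglongrightarrow> x" by real_asymp
      qed (use r in \<open>auto intro!: always_eventually less_imp_le\<close>)
      hence lim: "filterlim (\<lambda>n. of_rat (r n)) (at_right x) sequentially"
        using r by (auto simp: filterlim_at intro!: always_eventually)
      have "(\<lambda>n. cdf (K y) (of_rat (r n))) \<longlonglongrightarrow> cdf (K y) x"
        using K.cdf_is_right_cont[of x] lim by (auto simp: continuous_within intro: filterlim_compose)
      moreover have "(\<lambda>n. cdf (K y) (of_rat (r n))) \<longlonglongrightarrow> cdf (K' y) x"
        unfolding rat using K'.cdf_is_right_cont[of x] lim by (auto simp: continuous_within intro: filterlim_compose)
      ultimately show "cdf (K y) x = cdf (K' y) x"
        by (rule LIMSEQ_unique)
    qed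
    thus "K y = K' y"
      by (rule cdf_unique[OF K.real_distribution_axioms K'.real_distribution_axioms])
  qed
qed

text \<open>
  The choice in the definition of the conditional law ranges over a nonempty set, because the law along the
  orbit is a version; uniqueness then transfers statements between the two. For the converse direction, a
  law along the orbit that is almost surely \<open>C\<close> makes the constant kernel \<open>C\<close> a version as well, which avoids
  the question whether the set of planes with law \<open>C\<close> is measurable.
\<close>
lemma cond_law_plane_eq_iff:
  fixes U V :: "'w \<Rightarrow> real^'n" and C :: "real measure"
  assumes M: "haar_two_frame M U V" and f: "f \<in> frame_space \<rightarrow>\<^sub>M borel"
    and C: "prob_space C" "sets C = sets borel"
  defines "P \<equiv> \<lambda>\<omega>. oriented_span (U \<omega>, V \<omega>)" and "X \<equiv> \<lambda>\<omega>. f (U \<omega>, V \<omega>)"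
  shows "(AE p in distr M oriented_grassmannian P. cond_law M X borel P oriented_grassmannian p = C)
    \<longleftrightarrow> (AE \<omega> in M. orbit_law borel f (U \<omega>, V \<omega>) = C)"
proof -
  interpret prob_space M using M by (simp add: haar_two_frame_def)
  note UV [measurable] = haar_two_frame_measurable[OF M]
  have P [measurable]: "P \<in> M \<rightarrow>\<^sub>M oriented_grassmannian"
    unfolding P_def by measurable
  let ?K = "plane_law borel f" and ?reg = "regular_conditional_law M X borel P oriented_grassmannian"
  have K: "?reg ?K"
    unfolding P_def X_def by (rule regular_conditional_law_orbit[OF M f])
  hence cond: "?reg (cond_law M X borel P oriented_grassmannian)"
    unfolding cond_law_def by (rule someI[of ?reg])
  have K_P: "?K (P \<omega>) = orbit_law borel f (U \<omega>, V \<omega>)" if "\<omega> \<in> space M" for \<omega>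
    using measurable_space[OF UV that] unfolding P_def by (simp add: plane_law_oriented_span[OF f])
  show ?thesis
  proof
    assume "AE p in distr M oriented_grassmannian P. cond_law M X borel P oriented_grassmannian p = C"
    with regular_conditional_law_unique[OF prob_space_axioms P cond K]
    have "AE p in distr M oriented_grassmannian P. ?K p = C"
      by eventually_elim simp
    from AE_distrD[OF P this] AE_space show "AE \<omega> in M. orbit_law borel f (U \<omega>, V \<omega>) = C"
      by eventually_elim (simp add: K_P)
  next
    assume *: "AE \<omega> in M. orbit_law borel f (U \<omega>, V \<omega>) = C"
    have "?reg (\<lambda>_. C)"
      unfolding regular_conditional_law_def
    proof (intro conjI ballI)
      show "(\<lambda>_. C) \<in> oriented_grassmannian \<rightarrow>\<^sub>M prob_algebra borel"
        using C by (intro measurable_const) (simp add: space_prob_algebra)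
      fix A :: "'n oriented_plane set" and B :: "real set"
      assume "A \<in> sets oriented_grassmannian" "B \<in> sets borel"
      with K have "emeasure M {\<omega>\<in>space M. P \<omega> \<in> A \<and> X \<omega> \<in> B} =
          (\<integral>\<^sup>+\<omega>. emeasure (?K (P \<omega>)) B * indicator A (P \<omega>) \<partial>M)"
        by (simp add: regular_conditional_law_def)
      also have "\<dots> = (\<integral>\<^sup>+\<omega>. emeasure C B * indicator A (P \<omega>) \<partial>M)"
        using * AE_space by (intro nn_integral_cong_AE, eventually_elim) (simp add: K_P)
      finally show "emeasure M {\<omega>\<in>space M. P \<omega> \<in> A \<and> X \<omega> \<in> B} =
          (\<integral>\<^sup>+\<omega>. emeasure C B * indicator A (P \<omega>) \<partial>M)" .
    qed
    from regular_conditional_law_unique[OF prob_space_axioms P cond this]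
    show "AE p in distr M oriented_grassmannian P. cond_law M X borel P oriented_grassmannian p = C" .
  qed
qed

section \<open>Hyperplanes under laws invariant under orthogonal maps\<close>

text \<open>
  A point of a moment curve: the coordinates are powers with pairwise distinct exponents. A nonzero vector is orthogonal to only finitely many points of the curve.
\<close>
definition moment_vector :: "nat \<Rightarrow> real^'n::finite" where
  "moment_vector m = (\<chi> i. real m ^ to_nat i)"

lemma eventually_inner_moment_vector_nonzero:
  fixes x :: "real^'n"
  assumes "x \<noteq> 0"
  shows "\<forall>\<^sub>F m in sequentially. x \<bullet> moment_vector m \<noteq> 0"
proof -
  define p where "p = (\<Sum>i\<in>UNIV. monom (x $ i) (to_nat i))"
  have poly_p: "poly p (real m) = x \<bullet> moment_vector m" for m
    by (simp add: p_def poly_sum poly_monom inner_vec_def moment_vector_def)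
  obtain i where "x $ i \<noteq> 0"
    using assms by (auto simp: vec_eq_iff)
  moreover have "coeff p (to_nat i) = x $ i"
    by (simp add: p_def coeff_sum)
  ultimately have "p \<noteq> 0" by auto
  hence "finite {t. poly p t = 0}"
    by (rule poly_roots_finite)
  hence "finite (real -` {t. poly p t = 0})"
    by (rule finite_vimageI) (simp add: inj_def)
  hence "finite {m. \<not> (x \<bullet> moment_vector m \<noteq> 0)}"
    by (simp add: vimage_def poly_p)
  thus ?thesis
    by (simp add: cofinite_eq_sequentially[symmetric] eventually_cofinite)
qed

text \<open>
  If each outcome lies in only finitely many of the events, their probabilities tend to zero by dominated
  convergence.
\<close>
lemma (in prob_space) prob_eventually_vanishing_events:
  fixes E :: "nat \<Rightarrow> 'a set"
  assumes E: "\<And>n. E n \<in> events" and van: "AE \<omega> in M. \<forall>\<^sub>F n in sequentially. \<omega> \<notin> E n"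
    and q: "\<forall>\<^sub>F n in sequentially. prob (E n) = q"
  shows "q = 0"
proof -
  have "(\<lambda>n. LINT \<omega>|M. indicator (E n) \<omega> :: real) \<longlonglongrightarrow> (LINT \<omega>|M. 0)"
  proof (rule integral_dominated_convergence[where w = "\<lambda>_. 1"])
    show "AE \<omega> in M. (\<lambda>n. indicator (E n) \<omega> :: real) \<longlonglongrightarrow> 0"
      using van by eventually_elim (auto intro!: tendsto_eventually elim!: eventually_mono)
  qed (use E in \<open>auto intro!: AE_I2 simp: indicator_def\<close>)
  hence "(\<lambda>n. prob (E n)) \<longlonglongrightarrow> 0"
    using E by simp
  moreover have "(\<lambda>n. prob (E n)) \<longlonglongrightarrow> q"
    using q by (rule tendsto_eventually)
  ultimately show ?thesis
    using LIMSEQ_unique by blast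
qed

definition reflection :: "'a::real_inner \<Rightarrow> 'a \<Rightarrow> 'a" where
  "reflection w x = x - (2 * (x \<bullet> w) / (w \<bullet> w)) *\<^sub>R w"

lemma orthogonal_transformation_reflection:
  fixes w :: "'a::euclidean_space"
  shows "orthogonal_transformation (reflection w)"
  unfolding orthogonal_transformation_def
proof
  show "linear (reflection w)"
    unfolding reflection_def
    by (rule linearI) (auto simp: algebra_simps inner_add_left add_divide_distrib)
  show "\<forall>x y. reflection w x \<bullet> reflection w y = x \<bullet> y"
    by (cases "w = 0")
       (auto simp: reflection_def inner_diff_left inner_diff_right inner_commute field_simps)
qed

lemma reflection_swaps:
  assumes "norm x = norm y"
  shows "reflection (x - y) x = y"
proof (cases "x = y")
  case False
  have "x \<bullet> x = y \<bullet> y"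
    using assms by (simp add: norm_eq)
  hence "2 * (x \<bullet> (x - y)) = (x - y) \<bullet> (x - y)"
    by (simp add: inner_diff_left inner_diff_right inner_commute)
  moreover have "(x - y) \<bullet> (x - y) \<noteq> 0"
    using False by simp
  ultimately show ?thesis
    by (simp add: reflection_def)
qed (simp add: reflection_def)

lemma reflection_fixes_orthogonal: "x \<bullet> w = 0 \<Longrightarrow> reflection w x = x"
  by (simp add: reflection_def)

text \<open>
  All vectors \<open>a \<noteq> 0\<close> orthogonal to \<open>b\<close> give the same probability to their hyperplane, since a reflection that fixes
  \<open>b\<close> carries any unit vector orthogonal to \<open>b\<close> to any other. Among these vectors are the components orthogonal to
  \<open>b\<close> of points on the moment curve, and a given \<open>x \<noteq> 0\<close> orthogonal to \<open>b\<close> is orthogonal to only finitely many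
  of them. So the common probability
  is zero. With \<open>b = 0\<close> there is no constraint on the reflections.
\<close>
lemma AE_inner_nonzero:
  fixes \<rho> :: "(real^'n) measure"
  assumes "prob_space \<rho>" and sets: "sets \<rho> = sets borel"
    and inv: "\<And>g. orthogonal_transformation g \<Longrightarrow> g b = b \<Longrightarrow> distr \<rho> borel g = \<rho>"
    and nz: "AE x in \<rho>. x \<noteq> 0" and perp: "AE x in \<rho>. b \<bullet> x = 0"
    and a: "a \<noteq> 0" "a \<bullet> b = 0"
  shows "AE x in \<rho>. a \<bullet> x \<noteq> 0"
proof -
  interpret prob_space \<rho> by fact
  have space: "space \<rho> = UNIV"
    using sets_eq_imp_space_eq[OF sets] by simp
  have closed: "{x. d \<bullet> x = 0} \<in> sets borel" for d :: "real^'n"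
    by (intro borel_closed closed_hyperplane)
  have same: "prob {x. d \<bullet> x = 0} = prob {x. a \<bullet> x = 0}" if d: "d \<noteq> 0" "d \<bullet> b = 0" for d
  proof -
    define d' where "d' = (norm a / norm d) *\<^sub>R d"
    define g where "g = reflection (d' - a)"
    have g: "orthogonal_transformation g"
      unfolding g_def by (rule orthogonal_transformation_reflection)
    have "g d' = a"
      unfolding g_def using d by (intro reflection_swaps) (simp add: d'_def)
    have "g b = b"
      unfolding g_def using a d by (intro reflection_fixes_orthogonal) (simp add: d'_def inner_diff_right inner_commute)
    have meas: "g \<in> \<rho> \<rightarrow>\<^sub>M borel"
      using g by (subst measurable_cong_sets[OF sets refl])
        (auto intro!: borel_measurable_continuous_onI linear_continuous_on simp: orthogonal_transformation_def linear_linear)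
    have "prob {x. a \<bullet> x = 0} = measure (distr \<rho> borel g) {x. a \<bullet> x = 0}"
      using inv[OF g \<open>g b = b\<close>] by simp
    also have "\<dots> = prob {x. a \<bullet> g x = 0}"
      using meas closed by (subst measure_distr) (auto simp: space vimage_def)
    also have "a \<bullet> g x = d' \<bullet> x" for x
      using g unfolding \<open>g d' = a\<close>[symmetric] orthogonal_transformation_def by auto
    hence "{x. a \<bullet> g x = 0} = {x. d \<bullet> x = 0}"
      using a d by (auto simp: d'_def)
    finally show ?thesis ..
  qed
  \<comment> \<open>For \<open>b = 0\<close> the quotient is \<open>0\<close>, and \<open>d m\<close> is the point on the moment curve itself.\<close>
  define d where "d m = moment_vector m - ((moment_vector m \<bullet> b) / (b \<bullet> b)) *\<^sub>R b" for m
  have db: "d m \<bullet> b = 0" for m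
    by (cases "b = 0") (auto simp: d_def inner_diff_left)
  have "prob {x. a \<bullet> x = 0} = 0"
  proof (rule prob_eventually_vanishing_events)
    show "{x. d m \<bullet> x = 0} \<in> events" for m
      using closed sets by simp
    show "AE x in \<rho>. \<forall>\<^sub>F m in sequentially. x \<notin> {x. d m \<bullet> x = 0}"
      using nz perp
    proof eventually_elim
      case (elim x)
      from eventually_inner_moment_vector_nonzero[OF elim(1)] show ?case
      proof eventually_elim
        case (elim m)
        have "d m \<bullet> x = x \<bullet> moment_vector m"
          using \<open>b \<bullet> x = 0\<close> by (simp add: d_def inner_diff_left inner_commute[of "moment_vector m" x])
        thus ?case using elim by simp
      qed
    qed
    from eventually_inner_moment_vector_nonzero[OF a(1)]
    show "\<forall>\<^sub>F m in sequentially. prob {x. d m \<bullet> x = 0} = prob {x. a \<bullet> x = 0}"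
    proof eventually_elim
      case (elim m)
      have "a \<bullet> d m \<noteq> 0"
        using elim a by (simp add: d_def inner_diff_right)
      hence "d m \<noteq> 0" by auto
      thus ?case by (intro same db)
    qed
  qed
  hence "{x. a \<bullet> x = 0} \<in> null_sets \<rho>"
    using closed[of a] sets by (intro null_setsI) (auto simp: emeasure_eq_measure)
  from AE_not_in[OF this] show ?thesis by simp
qed

section \<open>Planes in general position\<close>

text \<open>
  The previous result for a vector built from the frame in a way that commutes with the orthogonal maps
  fixing \<open>b\<close>. It will be used for the first vector of the frame and for a vector of the plane that is
  orthogonal to \<open>b\<close>.
\<close>
lemma haar_two_frame_AE_inner_nonzero:
  fixes U V :: "'w \<Rightarrow> real^'n" and W :: "(real^'n) \<times> (real^'n) \<Rightarrow> real^'n"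
  assumes M: "haar_two_frame M U V" and W: "W \<in> frame_space \<rightarrow>\<^sub>M borel"
    and equiv: "\<And>g u v. orthogonal_transformation g \<Longrightarrow> g b = b \<Longrightarrow> W (g u, g v) = g (W (u, v))"
    and nz: "AE \<omega> in M. W (U \<omega>, V \<omega>) \<noteq> 0" and perp: "\<And>u v. b \<bullet> W (u, v) = 0"
    and a: "a \<noteq> 0" "a \<bullet> b = 0"
  shows "AE \<omega> in M. a \<bullet> W (U \<omega>, V \<omega>) \<noteq> 0"
proof -
  interpret prob_space M using M by (simp add: haar_two_frame_def)
  note UV [measurable] = haar_two_frame_measurable[OF M]
  note [measurable] = W
  define \<rho> where "\<rho> = distr M borel (\<lambda>\<omega>. W (U \<omega>, V \<omega>))"
  have "AE x in \<rho>. a \<bullet> x \<noteq> 0"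
  proof (rule AE_inner_nonzero)
    show "prob_space \<rho>"
      unfolding \<rho>_def by (rule prob_space_distr) measurable
    show "sets \<rho> = sets borel" by (simp add: \<rho>_def)
    show "AE x in \<rho>. x \<noteq> 0"
      unfolding \<rho>_def using nz by (subst AE_distr_iff) auto
    show "AE x in \<rho>. b \<bullet> x = 0"
      unfolding \<rho>_def using perp by (subst AE_distr_iff) auto
    fix g :: "real^'n \<Rightarrow> real^'n" assume g: "orthogonal_transformation g" "g b = b"
    have [measurable]: "g \<in> borel_measurable borel"
      using g(1) by (auto intro!: borel_measurable_continuous_onI linear_continuous_on
        simp: orthogonal_transformation_def linear_linear)
    have g_frame [measurable]: "(\<lambda>\<omega>. (g (U \<omega>), g (V \<omega>))) \<in> M \<rightarrow>\<^sub>M frame_space"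
    proof (rule measurable_into_frame_space)
      fix \<omega> assume "\<omega> \<in> space M"
      from measurable_space[OF UV this] show "(g (U \<omega>), g (V \<omega>)) \<in> orthonormal_frames"
        using g(1) by (auto simp: orthonormal_frames_iff orthogonal_transformation_def)
    next
      have [measurable]: "U \<in> borel_measurable M" "V \<in> borel_measurable M"
        using measurable_compose[OF UV measurable_frame_space_fst] measurable_compose[OF UV measurable_frame_space_snd]
        by simp_all
      show "(\<lambda>\<omega>. fst (g (U \<omega>), g (V \<omega>))) \<in> borel_measurable M" "(\<lambda>\<omega>. snd (g (U \<omega>), g (V \<omega>))) \<in> borel_measurable M"
        unfolding fst_conv snd_conv by measurable
    qed
    have "distr \<rho> borel g = distr M borel (\<lambda>\<omega>. W (g (U \<omega>), g (V \<omega>)))"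
      unfolding \<rho>_def equiv[OF g] by (subst distr_distr) (auto simp: o_def)
    also have "\<dots> = distr (distr M frame_space (\<lambda>\<omega>. (g (U \<omega>), g (V \<omega>)))) borel W"
      by (subst distr_distr) (auto simp: o_def)
    also have "\<dots> = \<rho>"
      unfolding haar_two_frame_orthogonal_transformation[OF M g(1)] \<rho>_def
      by (subst distr_distr) (auto simp: o_def)
    finally show "distr \<rho> borel g = \<rho>" .
  qed (use a in auto)
  thus ?thesis
    unfolding \<rho>_def by (intro AE_distrD[of _ M borel]) measurable
qed

lemma haar_two_frame_AE_nonorthogonal:
  assumes M: "haar_two_frame M U V" and a: "a \<noteq> 0"
  shows "AE \<omega> in M. a \<bullet> U \<omega> \<noteq> 0"
proof -
  have "AE \<omega> in M. a \<bullet> fst (U \<omega>, V \<omega>) \<noteq> 0"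
  proof (rule haar_two_frame_AE_inner_nonzero[OF M, where b = 0])
    have "U \<omega> \<noteq> 0" if "\<omega> \<in> space M" for \<omega>
      using measurable_space[OF haar_two_frame_measurable[OF M] that]
      by (auto simp: orthonormal_frames_iff)
    thus "AE \<omega> in M. fst (U \<omega>, V \<omega>) \<noteq> 0"
      by (intro AE_I2) simp
  qed (use a in auto)
  thus ?thesis by simp
qed

text \<open>
  The difference of the two sides is the inner product of \<open>a\<close> with the vector \<open>W = (b \<bullet> V) U - (b \<bullet> U) V\<close>, which is
  orthogonal to \<open>b\<close> and almost surely nonzero. It does not change when \<open>a\<close> is replaced by its component
  \<open>a'\<close> orthogonal to \<open>b\<close>.
\<close>
lemma haar_two_frame_AE_det_nonzero:
  assumes M: "haar_two_frame M U V" and ab: "a \<noteq> 0" "b \<noteq> 0" "span {a} \<noteq> span {b}"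
  shows "AE \<omega> in M. (b \<bullet> V \<omega>) * (a \<bullet> U \<omega>) \<noteq> (b \<bullet> U \<omega>) * (a \<bullet> V \<omega>)"
proof -
  define W where "W fr = (b \<bullet> snd fr) *\<^sub>R fst fr - (b \<bullet> fst fr) *\<^sub>R snd fr" for fr
  define t where "t = (a \<bullet> b) / (b \<bullet> b)"
  define a' where "a' = a - t *\<^sub>R b"
  have "a' \<noteq> 0"
  proof
    assume "a' = 0"
    hence a: "a = t *\<^sub>R b" by (simp add: a'_def)
    with ab have "t \<noteq> 0" by auto
    hence b: "b = (1 / t) *\<^sub>R a" by (simp add: a)
    have "a \<in> span {b}" by (subst a) (intro span_scale span_base, simp)
    moreover have "b \<in> span {a}" by (subst b) (intro span_scale span_base, simp)
    ultimately have "span {a} = span {b}"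
      by (intro equalityI span_minimal) auto
    thus False using ab by simp
  qed
  have "a' \<bullet> b = 0"
    using ab by (simp add: a'_def t_def inner_diff_left)
  have "AE \<omega> in M. a' \<bullet> W (U \<omega>, V \<omega>) \<noteq> 0"
  proof (rule haar_two_frame_AE_inner_nonzero[OF M])
    show "W \<in> frame_space \<rightarrow>\<^sub>M borel"
      unfolding W_def[abs_def] by measurable
    show "W (g u, g v) = g (W (u, v))" if g: "orthogonal_transformation g" "g b = b" for g u v
    proof -
      have "b \<bullet> g x = b \<bullet> x" for x
        using g by (metis orthogonal_transformation_def)
      thus ?thesis
        using g by (simp add: W_def orthogonal_transformation_def linear_diff linear_scale)
    qed
    show "b \<bullet> W (u, v) = 0" for u v
      by (simp add: W_def inner_diff_right)
    from haar_two_frame_AE_nonorthogonal[OF M ab(2)] AE_space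
    show "AE \<omega> in M. W (U \<omega>, V \<omega>) \<noteq> 0"
    proof eventually_elim
      case (elim \<omega>)
      have "(U \<omega>, V \<omega>) \<in> orthonormal_frames"
        using measurable_space[OF haar_two_frame_measurable[OF M] elim(2)] by simp
      hence "W (U \<omega>, V \<omega>) \<bullet> V \<omega> = - (b \<bullet> U \<omega>)"
        by (simp add: W_def inner_diff_left orthonormal_frames_iff)
      thus ?case using elim(1) by auto
    qed
  qed fact+
  thus ?thesis
  proof eventually_elim
    case (elim \<omega>)
    have "a' \<bullet> W (U \<omega>, V \<omega>) = (b \<bullet> V \<omega>) * (a \<bullet> U \<omega>) - (b \<bullet> U \<omega>) * (a \<bullet> V \<omega>)"
      by (simp add: a'_def W_def inner_diff_left inner_diff_right algebra_simps)
    with elim show ?case by simp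
  qed
qed

text \<open>
  The first condition is stronger than a nonzero projection of \<open>a\<^sub>j\<close> to the plane of the frame; the second is the
  determinant criterion for nonparallel vectors to have nonparallel projections.
\<close>
definition generic_frame :: "nat \<Rightarrow> (nat \<Rightarrow> real^'n) \<Rightarrow> (real^'n) \<times> (real^'n) \<Rightarrow> bool" where
  "generic_frame k a fr \<longleftrightarrow>
     (\<forall>j\<in>{1..k}. a j \<bullet> fst fr \<noteq> 0) \<and>
     (\<forall>i\<in>{1..k}. \<forall>j\<in>{1..k}. span {a i} \<noteq> span {a j} \<longrightarrow>
        (a j \<bullet> snd fr) * (a i \<bullet> fst fr) \<noteq> (a j \<bullet> fst fr) * (a i \<bullet> snd fr))"

lemma haar_two_frame_AE_generic:
  assumes M: "haar_two_frame M U V" and a: "\<And>j. j \<in> {1..k} \<Longrightarrow> a j \<noteq> 0"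
  shows "AE \<omega> in M. generic_frame k a (U \<omega>, V \<omega>)"
proof -
  have "AE \<omega> in M. \<forall>j\<in>{1..k}. a j \<bullet> U \<omega> \<noteq> 0"
    using a by (intro AE_finite_allI haar_two_frame_AE_nonorthogonal[OF M]) auto
  moreover have "AE \<omega> in M. \<forall>i\<in>{1..k}. \<forall>j\<in>{1..k}. span {a i} \<noteq> span {a j} \<longrightarrow>
      (a j \<bullet> V \<omega>) * (a i \<bullet> U \<omega>) \<noteq> (a j \<bullet> U \<omega>) * (a i \<bullet> V \<omega>)"
    using haar_two_frame_AE_det_nonzero[OF M a a]
    by (intro AE_finite_allI AE_impI finite_atLeastAtMost) auto
  ultimately show ?thesis
    by eventually_elim (simp add: generic_frame_def)
qed

section \<open>The field along the orbit\<close>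

lemma sum_combined_coeff:
  fixes h :: "(real^'n) set \<Rightarrow> real"
  shows "(\<Sum>L\<in>remaining_directions k a c. combined_coeff k a c L * h L) =
           (\<Sum>j\<in>{1..k}. c j * h (span {a j}))"
proof -
  let ?S = "(\<lambda>j. span {a j}) ` {1..k}"
  have "(\<Sum>j\<in>{1..k}. c j * h (span {a j})) =
      (\<Sum>L\<in>?S. \<Sum>j | j \<in> {1..k} \<and> span {a j} = L. c j * h (span {a j}))"
    by (rule sum.group[symmetric]) auto
  also have "\<dots> = (\<Sum>L\<in>?S. combined_coeff k a c L * h L)"
    by (intro sum.cong) (auto simp: combined_coeff_def sum_distrib_right intro!: sum.cong)
  also have "\<dots> = (\<Sum>L\<in>remaining_directions k a c. combined_coeff k a c L * h L)"
    by (rule sum.mono_neutral_right) (auto simp: remaining_directions_def)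
  finally show ?thesis ..
qed

lemma polar_pair:
  fixes x y :: real
  assumes "x \<noteq> 0"
  obtains r t where "r \<noteq> 0" "x = r * cos t" "y = r * sin t"
proof -
  have "(x / sqrt (x\<^sup>2 + y\<^sup>2))\<^sup>2 + (y / sqrt (x\<^sup>2 + y\<^sup>2))\<^sup>2 = 1"
    using assms by (simp add: power_divide add_divide_distrib[symmetric] add_pos_nonneg)
  then obtain t where "x / sqrt (x\<^sup>2 + y\<^sup>2) = cos t" "y / sqrt (x\<^sup>2 + y\<^sup>2) = sin t"
    by (rule sincos_total_2pi)
  moreover have "sqrt (x\<^sup>2 + y\<^sup>2) \<noteq> 0"
    using assms by simp
  ultimately show thesis
    by (intro that[of "sqrt (x\<^sup>2 + y\<^sup>2)" t]) (simp_all add: field_simps)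
qed

text \<open>
  Parallel vectors have parallel projections, so an angle modulo \<open>pi\<close> can be attached to each direction. The radius
  \<open>r\<close> may be negative.
\<close>
lemma generic_frame_angles:
  assumes "generic_frame k a (u, v)"
  obtains \<theta> where
    "\<And>j. j \<in> {1..k} \<Longrightarrow> \<exists>r. r \<noteq> 0 \<and> a j \<bullet> u = r * cos (\<theta> (span {a j})) \<and> a j \<bullet> v = r * sin (\<theta> (span {a j}))"
proof -
  have "\<exists>t. \<forall>j\<in>{1..k}. span {a j} = L \<longrightarrow> (\<exists>r. r \<noteq> 0 \<and> a j \<bullet> u = r * cos t \<and> a j \<bullet> v = r * sin t)" for L
  proof (cases "\<exists>i\<in>{1..k}. span {a i} = L")
    case True
    then obtain i where i: "i \<in> {1..k}" "span {a i} = L" by blast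
    from assms i have "a i \<bullet> u \<noteq> 0" by (simp add: generic_frame_def)
    then obtain r t where rt: "r \<noteq> 0" "a i \<bullet> u = r * cos t" "a i \<bullet> v = r * sin t"
      by (rule polar_pair)
    show ?thesis
    proof (rule exI[of _ t], intro ballI impI)
      fix j assume j: "j \<in> {1..k}" "span {a j} = L"
      hence "a j \<in> span {a i}" using i span_base[of "a j" "{a j}"] by simp
      then obtain s where s: "a j = s *\<^sub>R a i" by (auto simp: span_singleton)
      moreover have "a j \<bullet> u \<noteq> 0" using assms j by (simp add: generic_frame_def)
      ultimately have "s \<noteq> 0" by auto
      thus "\<exists>r. r \<noteq> 0 \<and> a j \<bullet> u = r * cos t \<and> a j \<bullet> v = r * sin t"
        using rt by (intro exI[of _ "s * r"]) (simp add: s)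
    qed
  qed auto
  then obtain \<theta> where "\<And>L. \<forall>j\<in>{1..k}. span {a j} = L \<longrightarrow>
      (\<exists>r. r \<noteq> 0 \<and> a j \<bullet> u = r * cos (\<theta> L) \<and> a j \<bullet> v = r * sin (\<theta> L))"
    by metis
  thus thesis by (intro that[of \<theta>]) blast
qed

text \<open>
  The ratio of the two inner products in each summand is a tangent. The identity holds at every angle: where some
  \<open>a\<^sub>j\<close> is orthogonal to the rotated first vector, the summand and the tangent are both \<open>0\<close>.
\<close>
lemma T_field_rotate_frame:
  assumes fr: "(u, v) \<in> orthonormal_frames"
    and \<theta>: "\<And>j. j \<in> {1..k} \<Longrightarrow> \<exists>r. r \<noteq> 0 \<and> a j \<bullet> u = r * cos (\<theta> (span {a j})) \<and> a j \<bullet> v = r * sin (\<theta> (span {a j}))"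
  shows "T_field k a c (fst (rotate_frame x (u, v))) \<bullet> snd (rotate_frame x (u, v)) =
           (\<Sum>L\<in>remaining_directions k a c. combined_coeff k a c L * tan (\<theta> L - x))"
proof -
  define u' v' where "u' = fst (rotate_frame x (u, v))" and "v' = snd (rotate_frame x (u, v))"
  have "u' \<bullet> v' = 0"
    using rotate_frame_orthonormal[OF fr, of x] by (simp add: u'_def v'_def orthonormal_frames_def case_prod_beta)
  hence "T_field k a c u' \<bullet> v' = (\<Sum>j\<in>{1..k}. c j * ((a j \<bullet> v') / (a j \<bullet> u')))"
    by (simp add: T_field_def inner_diff_left inner_sum_left)
  also have "\<dots> = (\<Sum>j\<in>{1..k}. c j * tan (\<theta> (span {a j}) - x))"
  proof (rule sum.cong[OF refl])
    fix j assume "j \<in> {1..k}"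
    from \<theta>[OF this] obtain r where r: "r \<noteq> 0" "a j \<bullet> u = r * cos (\<theta> (span {a j}))" "a j \<bullet> v = r * sin (\<theta> (span {a j}))"
      by blast
    have "a j \<bullet> u' = r * cos (\<theta> (span {a j}) - x)" "a j \<bullet> v' = r * sin (\<theta> (span {a j}) - x)"
      by (simp_all add: u'_def v'_def rotate_frame_def inner_add_right inner_diff_right r cos_diff sin_diff algebra_simps)
    thus "c j * ((a j \<bullet> v') / (a j \<bullet> u')) = c j * tan (\<theta> (span {a j}) - x)"
      using r(1) by (simp add: tan_def)
  qed
  also have "\<dots> = (\<Sum>L\<in>remaining_directions k a c. combined_coeff k a c L * tan (\<theta> L - x))"
    by (rule sum_combined_coeff[symmetric])
  finally show ?thesis by (simp add: u'_def v'_def)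
qed

text \<open>
  The angles of distinct remaining directions differ modulo \<open>pi\<close> by general position, so the poles of the tangents
  are distinct.
\<close>
lemma orbit_law_T_field_eq_cauchy_iff:
  assumes fr: "(u, v) \<in> orthonormal_frames" and gen: "generic_frame k a (u, v)"
    and c: "(\<Sum>j\<in>{1..k}. c j) = 1"
  shows "orbit_law borel (\<lambda>fr. T_field k a c (fst fr) \<bullet> snd fr) (u, v) = cauchy_distribution 0 1
    \<longleftrightarrow> (\<forall>L\<in>remaining_directions k a c. combined_coeff k a c L > 0)"
proof -
  obtain \<theta> where \<theta>: "\<And>j. j \<in> {1..k} \<Longrightarrow>
      \<exists>r. r \<noteq> 0 \<and> a j \<bullet> u = r * cos (\<theta> (span {a j})) \<and> a j \<bullet> v = r * sin (\<theta> (span {a j}))"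
    using generic_frame_angles[OF gen] by blast
  let ?D = "remaining_directions k a c" and ?b = "combined_coeff k a c"
  have "T_field k a c (fst (rotate_frame x (u, v))) \<bullet> snd (rotate_frame x (u, v)) =
      (\<Sum>L\<in>?D. ?b L * tan (\<theta> L - x))" for x
    by (rule T_field_rotate_frame[OF fr]) (rule \<theta>)
  hence "orbit_law borel (\<lambda>fr. T_field k a c (fst fr) \<bullet> snd fr) (u, v) =
      distr unit_uniform borel (\<lambda>s. \<Sum>L\<in>?D. ?b L * tan (\<theta> L - real 2 * pi * s))"
    by (simp add: orbit_law_def)
  \<comment> \<open>The angle \<open>2 * pi * s\<close> covers the full circle, on which each tangent runs through two periods.\<close>
  moreover have "distr unit_uniform borel (\<lambda>s. \<Sum>L\<in>?D. ?b L * tan (\<theta> L - real 2 * pi * s)) = cauchy_distribution 0 1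
      \<longleftrightarrow> (\<forall>L\<in>?D. ?b L > 0)"
  proof (rule distr_tangent_sum_eq_cauchy_iff)
    show "finite ?D" by (simp add: remaining_directions_def)
    show "?b L \<noteq> 0" if "L \<in> ?D" for L
      using that by (simp add: remaining_directions_def)
    show "(\<Sum>L\<in>?D. ?b L) = 1"
      using sum_combined_coeff[of k a c "\<lambda>_. 1"] c by simp
    fix L L' assume "L \<in> ?D" "L' \<in> ?D" "L \<noteq> L'"
    then obtain i j where ij: "i \<in> {1..k}" "j \<in> {1..k}" "L = span {a i}" "L' = span {a j}"
      unfolding remaining_directions_def by blast
    obtain r where r: "a i \<bullet> u = r * cos (\<theta> L)" "a i \<bullet> v = r * sin (\<theta> L)"
      using \<theta>[OF ij(1)] ij by auto
    obtain r' where r': "a j \<bullet> u = r' * cos (\<theta> L')" "a j \<bullet> v = r' * sin (\<theta> L')"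
      using \<theta>[OF ij(2)] ij by auto
    have "(a j \<bullet> v) * (a i \<bullet> u) - (a j \<bullet> u) * (a i \<bullet> v) = - (r * r' * sin (\<theta> L - \<theta> L'))"
      unfolding r r' by (simp add: sin_diff algebra_simps)
    moreover have "(a j \<bullet> v) * (a i \<bullet> u) - (a j \<bullet> u) * (a i \<bullet> v) \<noteq> 0"
      using gen ij \<open>L \<noteq> L'\<close> by (simp add: generic_frame_def)
    ultimately show "sin (\<theta> L - \<theta> L') \<noteq> 0" by auto
  qed simp
  ultimately show ?thesis by simp
qed

section \<open>The characterisation\<close>

theorem theorem6p2:
  fixes M :: "'w measure"
    and U V :: "'w \<Rightarrow> real^'n"
    and P :: "'w \<Rightarrow> 'n oriented_plane"
    and k :: nat
    and a :: "nat \<Rightarrow> real^'n"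
    and c :: "nat \<Rightarrow> real"
  assumes "CARD('n) \<ge> 2"
    and "haar_two_frame M U V"
    and "P = (\<lambda>\<omega>. oriented_span (U \<omega>, V \<omega>))"
    and "\<And>j. j \<in> {1..k} \<Longrightarrow> a j \<noteq> 0"
    and "(\<Sum>j\<in>{1..k}. c j) = 1"
  shows "(AE p in distr M oriented_grassmannian P.
            cond_law M (\<lambda>\<omega>. T_field k a c (U \<omega>) \<bullet> V \<omega>) borel P oriented_grassmannian p
              = cauchy_distribution 0 1)
         \<longleftrightarrow> (\<forall>L\<in>remaining_directions k a c. combined_coeff k a c L > 0)"
proof -
  note M = assms(2)
  interpret prob_space M using M by (simp add: haar_two_frame_def)
  define f where "f fr = T_field k a c (fst fr) \<bullet> snd fr" for fr
  have f: "f \<in> frame_space \<rightarrow>\<^sub>M borel"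
    unfolding f_def[abs_def] T_field_def by measurable
  have cauchy: "prob_space (cauchy_distribution 0 1)" "sets (cauchy_distribution 0 1) = sets borel"
    unfolding distr_tan_eq_cauchy[symmetric] by (auto intro!: unit_uniform.prob_space_distr)
  have "(AE p in distr M oriented_grassmannian P.
            cond_law M (\<lambda>\<omega>. T_field k a c (U \<omega>) \<bullet> V \<omega>) borel P oriented_grassmannian p
              = cauchy_distribution 0 1) \<longleftrightarrow>
        (AE \<omega> in M. orbit_law borel f (U \<omega>, V \<omega>) = cauchy_distribution 0 1)"
    using cond_law_plane_eq_iff[OF M f cauchy] unfolding assms(3) by (simp only: f_def fst_conv snd_conv)
  also have "\<dots> \<longleftrightarrow> (AE \<omega> in M. \<forall>L\<in>remaining_directions k a c. combined_coeff k a c L > 0)"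
  proof -
    have "AE \<omega> in M. generic_frame k a (U \<omega>, V \<omega>)"
      by (rule haar_two_frame_AE_generic[OF M]) (rule assms(4))
    from this AE_space
    have "AE \<omega> in M. orbit_law borel f (U \<omega>, V \<omega>) = cauchy_distribution 0 1 \<longleftrightarrow>
        (\<forall>L\<in>remaining_directions k a c. combined_coeff k a c L > 0)"
    proof eventually_elim
      case (elim \<omega>)
      have "(U \<omega>, V \<omega>) \<in> orthonormal_frames"
        using measurable_space[OF haar_two_frame_measurable[OF M] elim(2)] by simp
      from orbit_law_T_field_eq_cauchy_iff[OF this elim(1) assms(5)] show ?case
        unfolding f_def[abs_def] .
    qed
    thus ?thesis
      by (rule eventually_subst)
  qed
  also have "\<dots> \<longleftrightarrow> (\<forall>L\<in>remaining_directions k a c. combined_coeff k a c L > 0)"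
    by (rule AE_const)
  finally show ?thesis .
qed

end
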